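(* The positive-index map $\pi^+:\mathrm{span}_{\mathbb{Q}}\{\mathcal{I}^{\mathrm{adm}}\}\to\mathrm{span}_{\mathbb{Q}}\{\mathcal{I}^{\mathrm{adm}}_{>0}\}$ is a homomorphism of $\mathbb{Q}$-algebras for the stuffle product, i.e. $\pi^+(\Sigma\ast\Sigma')=\pi^+(\Sigma)\ast\pi^+(\Sigma')$ for all $\Sigma,\Sigma'\in\mathrm{span}_{\mathbb{Q}}\{\mathcal{I}^{\mathrm{adm}}\}$.
   Context: An integer index is a tuple $\mathbf{k}=(k_1,\dots,k_r)\in\mathbb{Z}^r$, $r\ge0$ ($\emptyset$ for $r=0$); $\mathcal{I}=\bigsqcup_{r\ge0}\mathbb{Z}^r$, $\mathcal{I}_{>0}=\bigsqcup_{r\ge0}\mathbb{Z}_{>0}^r$, and $\mathrm{span}_{\mathbb{Q}}\{S\}$ is the formal $\mathbb{Q}$-vector space with basis $S$. For $r\ge1$, $m_{\mathbf{k}}=\min_{1\le t\le r}\sum_{i=t}^r(k_i-1)$, and $m_\emptyset=\infty$. $\mathbf{k}$ is admissible if $m_{\mathbf{k}}>0$ and regularizable if $m_{\mathbf{k}}\ge0$; $\mathcal{I}^{\mathrm{adm}}$ is the set of admissible indices and $\mathcal{I}^{\mathrm{adm}}_{>0}=\mathcal{I}^{\mathrm{adm}}\cap\mathcal{I}_{>0}$. Positive-index map: Let $B_n^{\pm}$ be the Bernoulli numbers with $\frac{t}{1-e^{-t}}=\sum_n B_n^+\frac{t^n}{n!}$, $\frac{t}{e^t-1}=\sum_n B_n^-\frac{t^n}{n!}$.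 For a regularizable $\mathbf{k}=(k_1,\dots,k_r)$: if $\mathbf{k}\in\mathcal{I}_{>0}$ set $\pi^+(\mathbf{k})=\mathbf{k}$. Otherwise let $m$ be the smallest index with $k_m\le0$ (then $m<r$), and for $0\le i\le -k_m$ put $\mathbf{k}^+_{m,i}=(k_1,\dots,k_{m-1},k_{m+1}+k_m-1+i,k_{m+2},\dots,k_r)$, $\mathbf{k}_{\hat m}=(k_1,\dots,k_{m-1},k_{m+1},\dots,k_r)$, and if $m\ge2$, $\mathbf{k}^-_{m,i}=(k_1,\dots,k_{m-2},k_{m-1}+k_m-1+i,k_{m+1},\dots,k_r)$. Let $R(\mathbf{k})=\frac{1}{1-k_m}\sum_{i=0}^{-k_m}\binom{1-k_m}{i}B_i^-\mathbf{k}^+_{m,i}-\delta_{k_m,0}\mathbf{k}_{\hat m}-\epsilon_m\frac{1}{1-k_m}\sum_{i=0}^{-k_m}\binom{1-k_m}{i}B_i^+\mathbf{k}^-_{m,i}$, where $\epsilon_m=1$ if $m\ge2$ and $\epsilon_m=0$ if $m=1$. All indices in $R(\mathbf{k})$ have depth $r-1$ and are regularizable (admissible if $\mathbf{k}$ is), and one sets $\pi^+(\mathbf{k})=\pi^+(R(\mathbf{k}))$ (recursion on depth), extended $\mathbb{Q}$-linearly; this gives $\pi^+:\mathrm{span}_{\mathbb{Q}}\{\mathcal{I}^{\mathrm{adm}}\}\to\mathrm{span}_{\mathbb{Q}}\{\mathcal{I}^{\mathrm{adm}}_{>0}\}$. Stuffle product: the bilinear product $\ast$ on $\mathrm{span}_{\mathbb{Q}}\{\mathcal{I}\}$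 defined recursively by $\emptyset\ast\mathbf{k}=\mathbf{k}\ast\emptyset=\mathbf{k}$ and, for $\mathbf{k},\mathbf{k}'\in\mathcal{I}$, $k,k'\in\mathbb{Z}$, $(\mathbf{k},k)\ast(\mathbf{k}',k')=(\mathbf{k}\ast(\mathbf{k}',k'),k)+((\mathbf{k},k)\ast\mathbf{k}',k')+(\mathbf{k}\ast\mathbf{k}',k+k')$, where $(\mathbf{k},k)$ denotes concatenation and $(\Sigma,a)$ means appending $a$ to every index of $\Sigma$, extended linearly. $\mathrm{span}_{\mathbb{Q}}\{\mathcal{I}^{\mathrm{adm}}\}$ and $\mathrm{span}_{\mathbb{Q}}\{\mathcal{I}^{\mathrm{adm}}_{>0}\}$ are closed under $\ast$. *)

theory Defs
  imports
    Complex_Main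
    "HOL-Library.Poly_Mapping"
    "HOL-Library.Extended"
    "HOL-Library.FuncSet"
    "HOL-Computational_Algebra.Formal_Power_Series"
begin

section \<open>Indices\<close>

text \<open>
  An index (k_1, ..., k_r) is an integer list. Lists are counted from 0, so k_i is
  \<open>k ! (i - 1)\<close>.
\<close>

type_synonym index = "int list"

definition m_idx :: "index \<Rightarrow> int extended" where
  "m_idx k = (if k = [] then \<infinity>
              else Fin (Min ((\<lambda>t. \<Sum>i=t..<length k. k ! i - 1) ` {0..<length k})))"

definition admissible :: "index \<Rightarrow> bool" where
  "admissible k \<longleftrightarrow> m_idx k > 0"

definition regularizable :: "index \<Rightarrow> bool" where
  "regularizable k \<longleftrightarrow> m_idx k \<ge> 0"

definition positive_index :: "index \<Rightarrow> bool" where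
  "positive_index k \<longleftrightarrow> (\<forall>x\<in>set k. x > 0)"

definition I_adm :: "index set" where
  "I_adm = {k. admissible k}"

definition I_adm_pos :: "index set" where
  "I_adm_pos = {k. admissible k \<and> positive_index k}"

section \<open>Formal rational linear combinations\<close>

text \<open>
  The formal span of all indices is the type of finitely supported functions from indices to
  the rationals; the basis element of an index \<open>k\<close> is \<open>Poly_Mapping.single k 1\<close>.
\<close>

type_synonym index_comb = "index \<Rightarrow>\<^sub>0 rat"

definition qspan :: "index set \<Rightarrow> index_comb set" where
  "qspan S = {\<Sigma>. Poly_Mapping.keys \<Sigma> \<subseteq> S}"

definition qscale :: "rat \<Rightarrow> index_comb \<Rightarrow> index_comb" where
  "qscale c \<Sigma> = Poly_Mapping.map ((*) c) \<Sigma>"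

definition basis :: "index \<Rightarrow> index_comb" where
  "basis k = Poly_Mapping.single k 1"

definition lin_ext :: "(index \<Rightarrow> index_comb) \<Rightarrow> index_comb \<Rightarrow> index_comb" where
  "lin_ext f \<Sigma> = (\<Sum>k\<in>Poly_Mapping.keys \<Sigma>. qscale (Poly_Mapping.lookup \<Sigma> k) (f k))"

lemma lin_ext_cong [fundef_cong]:
  assumes "\<Sigma> = \<Sigma>'" and "\<And>k. k \<in> Poly_Mapping.keys \<Sigma>' \<Longrightarrow> f k = g k"
  shows "lin_ext f \<Sigma> = lin_ext g \<Sigma>'"
  using assms by (simp add: lin_ext_def)

section \<open>Stuffle product\<close>

definition append_entry :: "index_comb \<Rightarrow> int \<Rightarrow> index_comb" where
  "append_entry \<Sigma> a = lin_ext (\<lambda>k. basis (k @ [a])) \<Sigma>"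

function stuffle_index :: "index \<Rightarrow> index \<Rightarrow> index_comb" where
  "stuffle_index k k' =
     (if k = [] then basis k'
      else if k' = [] then basis k
      else append_entry (stuffle_index (butlast k) k') (last k)
         + append_entry (stuffle_index k (butlast k')) (last k')
         + append_entry (stuffle_index (butlast k) (butlast k')) (last k + last k'))"
  by pat_completeness auto
termination
  by (relation "measure (\<lambda>(k, k'). length k + length k')")
     (simp_all add: diff_less add_less_le_mono)

declare stuffle_index.simps [simp del]

lemma stuffle_index_Nil_left: "stuffle_index [] k = basis k"
  by (subst stuffle_index.simps) simp

lemma stuffle_index_Nil_right: "stuffle_index k [] = basis k"
  by (subst stuffle_index.simps) simp

lemma stuffle_index_snoc:
  "stuffle_index (k @ [a]) (k' @ [b]) =
     append_entry (stuffle_index k (k' @ [b])) a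
   + append_entry (stuffle_index (k @ [a]) k') b
   + append_entry (stuffle_index k k') (a + b)"
  by (subst stuffle_index.simps) simp

definition stuffle :: "index_comb \<Rightarrow> index_comb \<Rightarrow> index_comb" (infixl \<open>\<star>\<close> 70) where
  "\<Sigma> \<star> \<Sigma>' = lin_ext (\<lambda>k. lin_ext (\<lambda>k'. stuffle_index k k') \<Sigma>') \<Sigma>"

section \<open>The positive-index map\<close>

definition bernoulli_minus :: "nat \<Rightarrow> rat" where
  "bernoulli_minus n = fact n * fps_nth (fps_X / (fps_exp 1 - 1)) n"

definition bernoulli_plus :: "nat \<Rightarrow> rat" where
  "bernoulli_plus n = fact n * fps_nth (fps_X / (1 - fps_exp (-1))) n"

text \<open>
  In the next four definitions the position \<open>m\<close> is counted from 0. In particular the case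
  distinction on whether the first non-positive entry has a left neighbour reads \<open>m \<ge> 1\<close>.
\<close>

definition first_nonpos :: "index \<Rightarrow> nat" where
  "first_nonpos k = (LEAST m. m < length k \<and> k ! m \<le> 0)"

definition merge_right :: "index \<Rightarrow> nat \<Rightarrow> nat \<Rightarrow> index" where
  "merge_right k m i = take m k @ [k ! (m + 1) + k ! m - 1 + int i] @ drop (m + 2) k"

definition merge_left :: "index \<Rightarrow> nat \<Rightarrow> nat \<Rightarrow> index" where
  "merge_left k m i = take (m - 1) k @ [k ! (m - 1) + k ! m - 1 + int i] @ drop (m + 1) k"

definition remove_entry :: "index \<Rightarrow> nat \<Rightarrow> index" where
  "remove_entry k m = take m k @ drop (m + 1) k"

definition R_idx :: "index \<Rightarrow> index_comb" where
  "R_idx k =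
     (let m = first_nonpos k; km = k ! m in
        qscale (1 / of_int (1 - km))
          (\<Sum>i=0..nat (- km).
             qscale (of_nat (nat (1 - km) choose i) * bernoulli_minus i) (basis (merge_right k m i)))
      - (if km = 0 then basis (remove_entry k m) else 0)
      - (if m \<ge> 1 then
           qscale (1 / of_int (1 - km))
             (\<Sum>i=0..nat (- km).
                qscale (of_nat (nat (1 - km) choose i) * bernoulli_plus i) (basis (merge_left k m i)))
         else 0))"

lemma keys_qscale_subset: "Poly_Mapping.keys (qscale c p) \<subseteq> Poly_Mapping.keys p"
  by (auto simp: qscale_def in_keys_iff Poly_Mapping.map.rep_eq when_def)

lemma keys_qscale_sum_basis:
  "Poly_Mapping.keys (qscale c (\<Sum>i\<in>A. qscale (d i) (basis (f i)))) \<subseteq> f ` A"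
proof -
  have "Poly_Mapping.keys (\<Sum>i\<in>A. qscale (d i) (basis (f i)))
      \<subseteq> (\<Union>i\<in>A. Poly_Mapping.keys (qscale (d i) (basis (f i))))"
    by (rule keys_sum)
  also have "\<dots> \<subseteq> (\<Union>i\<in>A. Poly_Mapping.keys (basis (f i)))"
    using keys_qscale_subset by blast
  also have "\<dots> \<subseteq> f ` A"
    by (auto simp: basis_def)
  finally show ?thesis
    using keys_qscale_subset by blast
qed

lemma regularizable_last_pos:
  assumes "regularizable k" "k \<noteq> []"
  shows "last k > 0"
proof -
  let ?g = "\<lambda>t. \<Sum>i=t..<length k. k ! i - 1"
  have "0 \<le> Min (?g ` {0..<length k})"
    using assms by (simp add: regularizable_def m_idx_def zero_extended_def)
  also have "\<dots> \<le> ?g (length k - 1)"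
    using assms by (intro Min_le) auto
  also have "{length k - 1..<length k} = {length k - 1}"
    using assms by (cases k) auto
  finally show ?thesis
    using assms by (simp add: last_conv_nth)
qed

lemma first_nonpos:
  assumes "regularizable k" "\<not> positive_index k"
  shows "first_nonpos k + 1 < length k" "k ! first_nonpos k \<le> 0"
proof -
  have ex: "\<exists>m. m < length k \<and> k ! m \<le> 0"
    using assms(2) by (auto simp: positive_index_def in_set_conv_nth not_less)
  have m: "first_nonpos k < length k \<and> k ! first_nonpos k \<le> 0"
    unfolding first_nonpos_def using ex by (rule LeastI_ex)
  show "k ! first_nonpos k \<le> 0"
    using m by blast
  have ne: "k \<noteq> []"
    using m by auto
  have "first_nonpos k \<noteq> length k - 1"
    using m regularizable_last_pos[OF assms(1) ne] ne by (auto simp: last_conv_nth)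
  then show "first_nonpos k + 1 < length k"
    using m by linarith
qed

lemma length_keys_R_idx:
  assumes "regularizable k" "\<not> positive_index k" "k' \<in> Poly_Mapping.keys (R_idx k)"
  shows "length k' + 1 = length k"
proof -
  let ?m = "first_nonpos k"
  note m = first_nonpos(1)[OF assms(1,2)]
  let ?km = "k ! first_nonpos k"
  let ?A = "{0..nat (- ?km)}"
  let ?P = "qscale (1 / of_int (1 - ?km)) (\<Sum>i\<in>?A.
    qscale (of_nat (nat (1 - ?km) choose i) * bernoulli_minus i) (basis (merge_right k ?m i)))"
  let ?Q = "if ?km = 0 then basis (remove_entry k ?m) else 0"
  let ?S = "if ?m \<ge> 1 then qscale (1 / of_int (1 - ?km)) (\<Sum>i\<in>?A.
    qscale (of_nat (nat (1 - ?km) choose i) * bernoulli_plus i) (basis (merge_left k ?m i))) else 0"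
  have P: "Poly_Mapping.keys ?P \<subseteq> merge_right k ?m ` ?A"
    by (rule keys_qscale_sum_basis)
  have Q: "Poly_Mapping.keys ?Q \<subseteq> {remove_entry k ?m}"
    by (simp add: basis_def)
  have S: "Poly_Mapping.keys ?S \<subseteq> (if ?m \<ge> 1 then merge_left k ?m ` ?A else {})"
  proof (cases "?m \<ge> 1")
    case True
    show ?thesis
      unfolding if_P[OF True] by (rule keys_qscale_sum_basis)
  qed simp
  have "k' \<in> Poly_Mapping.keys (?P - ?Q - ?S)"
    using assms(3) unfolding R_idx_def Let_def .
  then have "k' \<in> Poly_Mapping.keys ?P \<union> Poly_Mapping.keys ?Q \<union> Poly_Mapping.keys ?S"
    using keys_diff[of "?P - ?Q" ?S] keys_diff[of ?P ?Q] by blast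
  then have "k' \<in> merge_right k ?m ` ?A \<union> {remove_entry k ?m} \<union>
      (if ?m \<ge> 1 then merge_left k ?m ` ?A else {})"
    using P Q S by blast
  then show ?thesis
    using m by (auto simp: merge_right_def merge_left_def remove_entry_def split: if_splits)
qed

text \<open>The map is defined on regularizable indices only; outside it takes the junk value 0.\<close>

function pi_plus_index :: "index \<Rightarrow> index_comb" where
  "pi_plus_index k =
     (if \<not> regularizable k then 0
      else if positive_index k then basis k
      else lin_ext pi_plus_index (R_idx k))"
  by pat_completeness auto
termination
  by (relation "measure length") (auto dest: length_keys_R_idx)

declare pi_plus_index.simps [simp del]

definition pi_plus :: "index_comb \<Rightarrow> index_comb" where
  "pi_plus \<Sigma> = lin_ext pi_plus_index \<Sigma>"

end

theory Submission
  imports Defs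
    "HOL-Computational_Algebra.Polynomial"
    "HOL-Computational_Algebra.Primes"
begin

text \<open>
  An index \<open>k\<close> of depth \<open>r\<close> defines the truncated sum of \<open>n_1 powi (- k_1) * ... * n_r powi (- k_r)\<close>
  over \<open>0 < n_1 < ... < n_r < N\<close>, a function of \<open>N\<close>. Its linear extension is multiplicative for the
  stuffle product. It is invariant under \<open>pi_plus\<close>: the terms of \<open>R_idx\<close> are Faulhaber's formula for
  the sum of \<open>l ^ p\<close> over \<open>j < l < n\<close>, applied to the summation variable of the first non-positive
  entry, and the bound \<open>N\<close> is never touched because that entry is not the last one. It remains to see
  that the functions of positive indices are linearly independent. If all entries are positive, the
  sum up to \<open>M * p + j\<close>, scaled by \<open>p\<close> to the power of the weight, is congruent modulo a large prime
  \<open>p\<close> to the sum up to \<open>M\<close>, which allows an induction on the depth.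
\<close>

section \<open>Linear extensions\<close>

text \<open>The rational-valued counterpart of \<open>lin_ext\<close>. Coefficients and truncated
  sums of combinations both arise from it, so its linearity serves for both.\<close>

definition pairing :: "(index \<Rightarrow> rat) \<Rightarrow> index_comb \<Rightarrow> rat" where
  "pairing f X = (\<Sum>k\<in>Poly_Mapping.keys X. Poly_Mapping.lookup X k * f k)"

lemma lookup_qscale: "Poly_Mapping.lookup (qscale c X) k = c * Poly_Mapping.lookup X k"
  by (simp add: qscale_def Poly_Mapping.map.rep_eq when_def)

text \<open>Coefficients outside the support are zero. A common finite index set makes combinations
  with different supports comparable.\<close>

lemma pairing_superset:
  assumes "finite A" "Poly_Mapping.keys X \<subseteq> A"
  shows "pairing f X = (\<Sum>k\<in>A. Poly_Mapping.lookup X k * f k)"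
  unfolding pairing_def using assms by (intro sum.mono_neutral_left) (auto simp: in_keys_iff)

lemma pairing_zero [simp]: "pairing f 0 = 0"
  by (simp add: pairing_def)

lemma pairing_add: "pairing f (X + Y) = pairing f X + pairing f Y"
proof -
  let ?A = "Poly_Mapping.keys X \<union> Poly_Mapping.keys Y"
  have "pairing f Z = (\<Sum>k\<in>?A. Poly_Mapping.lookup Z k * f k)" if "Z \<in> {X, Y, X + Y}" for Z
    using that by (intro pairing_superset) (use Poly_Mapping.keys_add[of X Y] in auto)
  then show ?thesis
    by (simp add: lookup_add distrib_right sum.distrib)
qed

lemma pairing_qscale: "pairing f (qscale c X) = c * pairing f X"
proof -
  have "pairing f (qscale c X)
      = (\<Sum>k\<in>Poly_Mapping.keys X. Poly_Mapping.lookup (qscale c X) k * f k)"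
    by (rule pairing_superset) (simp_all add: keys_qscale_subset)
  then show ?thesis
    by (simp add: lookup_qscale pairing_def sum_distrib_left mult.assoc)
qed

lemma pairing_diff: "pairing f (X - Y) = pairing f X - pairing f Y"
  using pairing_add[of f "X - Y" Y] by simp

lemma pairing_sum: "pairing f (\<Sum>i\<in>I. X i) = (\<Sum>i\<in>I. pairing f (X i))"
  by (induction I rule: infinite_finite_induct) (simp_all add: pairing_add)

lemma pairing_basis [simp]: "pairing f (basis k) = f k"
  by (simp add: pairing_def basis_def)

lemma pairing_lin_ext: "pairing f (lin_ext g X) = pairing (\<lambda>k. pairing f (g k)) X"
  by (simp add: lin_ext_def pairing_sum pairing_qscale pairing_def[of _ X])

lemma pairing_cong:
  "(\<And>k. k \<in> Poly_Mapping.keys X \<Longrightarrow> f k = g k) \<Longrightarrow> pairing f X = pairing g X"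
  by (simp add: pairing_def)

text \<open>Each coefficient of \<open>lin_ext g X\<close> is a \<open>pairing\<close>, so the
  linearity of \<open>lin_ext\<close> is inherited coefficientwise.\<close>

lemma lookup_lin_ext:
  "Poly_Mapping.lookup (lin_ext g X) k = pairing (\<lambda>j. Poly_Mapping.lookup (g j) k) X"
  by (simp add: lin_ext_def lookup_sum lookup_qscale pairing_def)

lemma lin_ext_add: "lin_ext g (X + Y) = lin_ext g X + lin_ext g Y"
  by (rule poly_mapping_eqI) (simp add: lookup_lin_ext lookup_add pairing_add)

lemma lin_ext_qscale: "lin_ext g (qscale c X) = qscale c (lin_ext g X)"
  by (rule poly_mapping_eqI) (simp add: lookup_lin_ext lookup_qscale pairing_qscale)

lemma lin_ext_basis [simp]: "lin_ext g (basis k) = g k"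
  by (rule poly_mapping_eqI) (simp add: lookup_lin_ext)

lemma keys_lin_ext:
  "Poly_Mapping.keys (lin_ext g X) \<subseteq> (\<Union>k\<in>Poly_Mapping.keys X. Poly_Mapping.keys (g k))"
proof
  fix j
  assume "j \<in> Poly_Mapping.keys (lin_ext g X)"
  then have "pairing (\<lambda>k. Poly_Mapping.lookup (g k) j) X \<noteq> 0"
    by (simp add: in_keys_iff lookup_lin_ext)
  then obtain k where "k \<in> Poly_Mapping.keys X" "Poly_Mapping.lookup (g k) j \<noteq> 0"
    unfolding pairing_def by (metis (no_types, lifting) mult_zero_right sum.neutral)
  then show "j \<in> (\<Union>k\<in>Poly_Mapping.keys X. Poly_Mapping.keys (g k))"
    by (auto simp: in_keys_iff)
qed

section \<open>Truncated sums\<close>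

text \<open>The outermost and largest summation variable belongs to the last entry of an index,
  while list recursion peels off the first; hence the recursion on the reversed index.\<close>

primrec mhs_rev :: "index \<Rightarrow> nat \<Rightarrow> rat" where
  "mhs_rev [] N = 1"
| "mhs_rev (a # k) N = (\<Sum>n=1..<N. of_nat n powi (- a) * mhs_rev k n)"

definition mhs :: "index \<Rightarrow> nat \<Rightarrow> rat" where
  "mhs k = mhs_rev (rev k)"

lemma mhs_Nil [simp]: "mhs [] N = 1"
  by (simp add: mhs_def)

lemma mhs_snoc: "mhs (k @ [a]) N = (\<Sum>n=1..<N. of_nat n powi (- a) * mhs k n)"
  by (simp add: mhs_def)

lemma mhs_snoc_1 [simp]: "mhs (k @ [a]) (Suc 0) = 0"
  by (simp add: mhs_snoc)

lemma mhs_snoc_Suc: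
  "n > 0 \<Longrightarrow> mhs (k @ [a]) (Suc n) = mhs (k @ [a]) n + of_nat n powi (- a) * mhs k n"
  by (simp add: mhs_snoc sum.atLeastLessThan_Suc)

lemma pairing_mhs_append_entry:
  "pairing (\<lambda>k. mhs k N) (append_entry X a)
    = (\<Sum>n=1..<N. of_nat n powi (- a) * pairing (\<lambda>k. mhs k n) X)"
  unfolding append_entry_def pairing_lin_ext pairing_basis mhs_snoc
  unfolding pairing_def sum_distrib_left
  by (subst sum.swap) (simp add: mult_ac)

text \<open>The pairs of summation variables are split by which one is larger, with the diagonal as
  the third part. These are the three terms of the stuffle recursion.\<close>

lemma sum_mult_sum_split:
  fixes f g :: "nat \<Rightarrow> 'a :: comm_ring"
  shows "(\<Sum>n=1..<N. f n) * (\<Sum>n=1..<N. g n)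
    = (\<Sum>n=1..<N. f n * (\<Sum>m=1..<n. g m)) + (\<Sum>n=1..<N. g n * (\<Sum>m=1..<n. f m))
      + (\<Sum>n=1..<N. f n * g n)"
proof (induction N)
  case (Suc N)
  show ?case
  proof (cases "N = 0")
    case False
    then show ?thesis
      using Suc by (simp add: sum.atLeastLessThan_Suc algebra_simps)
  qed simp
qed simp

text \<open>Once the largest variable \<open>n\<close> is fixed, the inner sums have bound
  \<open>n\<close>, so the induction hypothesis is needed at every bound and not only at
  \<open>N\<close>.\<close>

lemma pairing_mhs_stuffle_index:
  "pairing (\<lambda>j. mhs j N) (stuffle_index k k') = mhs k N * mhs k' N"
proof (induction "length k + length k'" arbitrary: k k' N rule: less_induct)
  case less
  show ?case
  proof (cases "k = [] \<or> k' = []")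
    case True
    then show ?thesis
      by (auto simp: stuffle_index_Nil_left stuffle_index_Nil_right)
  next
    case False
    then obtain u a u' b where k: "k = u @ [a]" "k' = u' @ [b]"
      by (metis rev_exhaust)
    have IH: "pairing (\<lambda>j. mhs j n) (stuffle_index u k') = mhs u n * mhs k' n"
      "pairing (\<lambda>j. mhs j n) (stuffle_index k u') = mhs k n * mhs u' n"
      "pairing (\<lambda>j. mhs j n) (stuffle_index u u') = mhs u n * mhs u' n" for n
      by (rule less; simp add: k)+
    have "(\<Sum>n=1..<N. of_nat n powi (- (a + b)) * (mhs u n * mhs u' n))
        = (\<Sum>n=1..<N. (of_nat n powi (- a) * mhs u n) * (of_nat n powi (- b) * mhs u' n))"
      by (intro sum.cong) (simp_all add: power_int_add[of _ "- a" "- b", simplified])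
    then have "mhs k N * mhs k' N
        = (\<Sum>n=1..<N. of_nat n powi (- a) * (mhs u n * mhs k' n))
          + (\<Sum>n=1..<N. of_nat n powi (- b) * (mhs k n * mhs u' n))
          + (\<Sum>n=1..<N. of_nat n powi (- (a + b)) * (mhs u n * mhs u' n))"
      unfolding k mhs_snoc sum_mult_sum_split by (simp only: mult_ac)
    moreover have "pairing (\<lambda>j. mhs j N) (stuffle_index k k')
        = (\<Sum>n=1..<N. of_nat n powi (- a) * pairing (\<lambda>j. mhs j n) (stuffle_index u k'))
          + (\<Sum>n=1..<N. of_nat n powi (- b) * pairing (\<lambda>j. mhs j n) (stuffle_index k u'))
          + (\<Sum>n=1..<N. of_nat n powi (- (a + b)) * pairing (\<lambda>j. mhs j n) (stuffle_index u u'))"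
      by (simp only: k stuffle_index_snoc pairing_add pairing_mhs_append_entry)
    ultimately show ?thesis
      by (simp only: IH)
  qed
qed

lemma pairing_mhs_stuffle:
  "pairing (\<lambda>k. mhs k N) (X \<star> Y) = pairing (\<lambda>k. mhs k N) X * pairing (\<lambda>k. mhs k N) Y"
proof -
  have "pairing (\<lambda>k'. mhs k N * mhs k' N) Y = mhs k N * pairing (\<lambda>k'. mhs k' N) Y" for k
    by (simp add: pairing_def sum_distrib_left mult_ac)
  then show ?thesis
    unfolding stuffle_def pairing_lin_ext pairing_mhs_stuffle_index
    by (simp add: pairing_def[of _ X] sum_distrib_left mult_ac)
qed

section \<open>Faulhaber's formula\<close>

text \<open>The polynomial in \<open>n\<close> behind both sums of \<open>R_idx\<close> for an entry
  \<open>- int p\<close>. The sequence \<open>B\<close> is a parameter so that both Bernoulli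
  conventions share it.\<close>

definition faulhaber :: "(nat \<Rightarrow> rat) \<Rightarrow> nat \<Rightarrow> nat \<Rightarrow> rat" where
  "faulhaber B p n
    = 1 / of_nat (Suc p) * (\<Sum>i=0..p. of_nat (Suc p choose i) * B i * of_nat n ^ (Suc p - i))"

text \<open>A Cauchy product with \<open>F\<close> as exponential generating function of
  \<open>B\<close>. Subtracting 1 from the exponential kills the term \<open>i = Suc p\<close>, so
  the sum stops at \<open>p\<close>.\<close>

lemma faulhaber_fps:
  fixes F :: "rat fps"
  assumes "\<And>i. B i = fact i * fps_nth F i"
  shows "faulhaber B p n = fact p * fps_nth (F * (fps_exp (of_nat n) - 1)) (Suc p)"
proof -
  have "fps_nth (F * (fps_exp (of_nat n) - 1)) (Suc p)
      = (\<Sum>i=0..p. fps_nth F i * of_nat n ^ (Suc p - i) / fact (Suc p - i))"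
    by (simp add: fps_mult_nth sum.atLeast0_atMost_Suc Suc_diff_le)
  moreover have "of_nat (Suc p choose i) * B i * of_nat n ^ (Suc p - i) / of_nat (Suc p)
      = fact p * (fps_nth F i * of_nat n ^ (Suc p - i) / fact (Suc p - i))" if "i \<le> p" for i
  proof -
    have "of_nat (Suc p choose i) * fact i / (of_nat (Suc p) :: rat) = fact p / fact (Suc p - i)"
      using that by (subst binomial_fact) (auto simp del: of_nat_Suc simp: divide_simps)
    then show ?thesis
      by (simp add: assms field_simps del: of_nat_Suc)
  qed
  ultimately show ?thesis
    by (simp add: faulhaber_def sum_distrib_left sum_divide_distrib[symmetric] del: of_nat_Suc)
qed

text \<open>The divisor has subdegree 1 and therefore divides \<open>fps_X\<close>, so the division
  in the Bernoulli generating functions is exact.\<close>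

lemma fps_X_div_mult:
  fixes F :: "rat fps"
  assumes "fps_nth F 0 = 0" "fps_nth F 1 \<noteq> 0"
  shows "fps_X / F * F = fps_X"
proof -
  have "subdegree F = 1"
    using assms by (intro subdegreeI) auto
  then have "F dvd fps_X"
    using assms by (subst fps_dvd_iff) auto
  then show ?thesis
    by (rule dvd_div_mult_self)
qed

text \<open>A geometric series in e^t. Its factor e^t - 1 cancels the denominator of the Bernoulli
  generating function and leaves t times the generating function of the power sums.\<close>

lemma sum_fps_exp_telescope:
  "(fps_exp 1 - 1) * (\<Sum>l<n. fps_exp (of_nat l :: rat)) = fps_exp (of_nat n) - 1"
  by (induction n) (simp_all add: algebra_simps fps_exp_add_mult)

lemma faulhaber_bernoulli_minus:
  "faulhaber bernoulli_minus p n = (\<Sum>l<n. of_nat l ^ p)"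
proof -
  let ?G = "fps_exp 1 - 1 :: rat fps"
  have "fps_X / ?G * (fps_exp (of_nat n) - 1) = fps_X * (\<Sum>l<n. fps_exp (of_nat l))"
    using fps_X_div_mult[of ?G] by (simp flip: sum_fps_exp_telescope mult.assoc)
  then show ?thesis
    by (subst faulhaber_fps[of _ "fps_X / ?G"])
      (simp_all add: bernoulli_minus_def fps_sum_nth sum_distrib_left)
qed

lemma faulhaber_bernoulli_plus:
  "faulhaber bernoulli_plus p n = (\<Sum>l<n. of_nat (Suc l) ^ p)"
proof -
  let ?G = "1 - fps_exp (-1) :: rat fps"
  \<comment> \<open>Pulling out e^t produces the denominator 1 - e^(-t) and moves the exponents from
    0..n-1 to 1..n.\<close>
  have e: "fps_exp 1 - 1 = ?G * fps_exp 1"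
    by (simp add: algebra_simps flip: fps_exp_add_mult)
  have "fps_X / ?G * (fps_exp (of_nat n) - 1)
      = fps_X / ?G * ?G * (fps_exp 1 * (\<Sum>l<n. fps_exp (of_nat l)))"
    by (simp only: sum_fps_exp_telescope[symmetric] e mult.assoc)
  also have "\<dots> = fps_X * (\<Sum>l<n. fps_exp (of_nat (Suc l)))"
    by (simp add: fps_X_div_mult sum_distrib_left flip: fps_exp_add_mult)
  finally show ?thesis
    by (subst faulhaber_fps[of _ "fps_X / ?G"])
      (simp_all add: bernoulli_plus_def fps_sum_nth sum_distrib_left del: of_nat_Suc)
qed

section \<open>Invariance of truncated sums under reduction\<close>

text \<open>Only the summand \<open>l = 0\<close> is left, and \<open>0 ^ 0 = 1\<close>. This is the
  origin of the correction for \<open>p = 0\<close>, which appears in \<open>R_idx\<close> as the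
  index with the entry removed.\<close>

lemma faulhaber_minus_1: "faulhaber bernoulli_minus p (Suc 0) = (if p = 0 then 1 else 0)"
  by (simp add: faulhaber_bernoulli_minus)

lemma faulhaber_minus_Suc:
  "faulhaber bernoulli_minus p (Suc n) = faulhaber bernoulli_minus p n + of_nat n ^ p"
  by (simp add: faulhaber_bernoulli_minus)

lemma faulhaber_minus_Suc_plus:
  "faulhaber bernoulli_minus p (Suc n)
    = (if p = 0 then 1 else 0) + faulhaber bernoulli_plus p n"
  unfolding faulhaber_bernoulli_minus faulhaber_bernoulli_plus sum.lessThan_Suc_shift by simp

lemma mhs_snoc_nonpos_Nil:
  assumes "n > 0"
  shows "mhs [- int p] n
    = faulhaber bernoulli_minus p n - (if p = 0 then 1 else 0)"
  using assms
proof (induction n rule: nat_induct_non_zero)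
  case 1
  then show ?case
    using mhs_snoc_1[of "[]" "- int p"] by (simp add: faulhaber_minus_1)
next
  case (Suc n)
  then show ?case
    using mhs_snoc_Suc[of n "[]" "- int p"] by (simp add: faulhaber_minus_Suc)
qed

text \<open>Summation by parts: the inner sum of \<open>l ^ p\<close> over \<open>j < l < n\<close> is a polynomial in \<open>n\<close> minus
  a polynomial in \<open>j\<close>.\<close>

lemma mhs_snoc_nonpos_snoc:
  assumes "n > 0"
  shows "mhs (u @ [a, - int p]) n
    = (faulhaber bernoulli_minus p n - (if p = 0 then 1 else 0)) * mhs (u @ [a]) n
      - (\<Sum>j=1..<n. faulhaber bernoulli_plus p j * (of_nat j powi (- a) * mhs u j))"
  using assms
proof (induction n rule: nat_induct_non_zero)
  case 1
  then show ?case
    using mhs_snoc_1[of "u @ [a]" "- int p"] by simp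
next
  case (Suc n)
  have "mhs (u @ [a, - int p]) (Suc n)
      = mhs (u @ [a, - int p]) n + of_nat n ^ p * mhs (u @ [a]) n"
    using mhs_snoc_Suc[of n "u @ [a]" "- int p"] Suc by simp
  moreover have "(\<Sum>j=1..<Suc n. faulhaber bernoulli_plus p j * (of_nat j powi (- a) * mhs u j))
      = (\<Sum>j=1..<n. faulhaber bernoulli_plus p j * (of_nat j powi (- a) * mhs u j))
        + faulhaber bernoulli_plus p n * (of_nat n powi (- a) * mhs u n)"
    using Suc by (simp add: sum.atLeastLessThan_Suc)
  moreover note Suc.IH
  moreover have "faulhaber bernoulli_plus p n
      = faulhaber bernoulli_minus p n + of_nat n ^ p - (if p = 0 then 1 else 0)"
    using faulhaber_minus_Suc[of p n] faulhaber_minus_Suc_plus[of p n] by simp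
  moreover have "mhs (u @ [a]) (Suc n) = mhs (u @ [a]) n + of_nat n powi (- a) * mhs u n"
    using Suc by (simp add: mhs_snoc_Suc)
  ultimately show ?case
    by (simp only: faulhaber_minus_Suc) (simp only: algebra_simps)
qed

text \<open>Multiplied by a power of \<open>n\<close>, every monomial of the Faulhaber polynomial is
  again a power of \<open>n\<close>; the resulting exponents are the merged entries of
  \<open>R_idx\<close>.\<close>

lemma faulhaber_mult_powi:
  assumes "n > 0"
  shows "faulhaber B p n * of_nat n powi (- b)
    = 1 / of_nat (Suc p) * (\<Sum>i=0..p. of_nat (Suc p choose i) * B i
        * of_nat n powi (- (b - int p - 1 + int i)))"
proof -
  have "of_nat n ^ (Suc p - i) * of_nat n powi (- b)
      = (of_nat n powi (- (b - int p - 1 + int i)) :: rat)" if "i \<le> p" for i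
  proof -
    have "of_nat n powi (- (b - int p - 1 + int i))
        = (of_nat n powi (int (Suc p - i) + - b) :: rat)"
      using that by (intro arg_cong[of _ _ "\<lambda>e. _ powi e"]) (simp add: of_nat_diff)
    also have "\<dots> = of_nat n ^ (Suc p - i) * of_nat n powi (- b)"
      using assms by (subst power_int_add) simp_all
    finally show ?thesis ..
  qed
  then show ?thesis
    unfolding faulhaber_def mult.assoc sum_distrib_right
    by (intro arg_cong2[of _ _ _ _ "(*)"] sum.cong) (simp_all add: mult.assoc)
qed

text \<open>Entries to the right of the reduction only add outer summations, which commute with the
  finite combination.\<close>

lemma mhs_lincomb_snoc:
  "C * (\<Sum>i\<in>I. d i * mhs (w i @ [c]) N)
    = (\<Sum>n=1..<N. of_nat n powi (- c) * (C * (\<Sum>i\<in>I. d i * mhs (w i) n)))"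
  unfolding mhs_snoc sum_distrib_left by (subst sum.swap) (simp only: mult_ac)

lemma sum_faulhaber_mhs:
  "(\<Sum>n=1..<N. faulhaber B p n * (of_nat n powi (- b) * mhs u n))
    = 1 / of_nat (Suc p) * (\<Sum>i=0..p. of_nat (Suc p choose i) * B i
        * mhs (u @ [b - int p - 1 + int i]) N)"
proof -
  have "(\<Sum>n=1..<N. faulhaber B p n * (of_nat n powi (- b) * mhs u n))
      = (\<Sum>n=1..<N. 1 / of_nat (Suc p) * (\<Sum>i=0..p. of_nat (Suc p choose i) * B i
        * of_nat n powi (- (b - int p - 1 + int i))) * mhs u n)"
    by (intro sum.cong refl) (subst faulhaber_mult_powi[symmetric], simp_all add: mult.assoc)
  also have "\<dots> = 1 / of_nat (Suc p) * (\<Sum>i=0..p. of_nat (Suc p choose i) * B i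
        * mhs (u @ [b - int p - 1 + int i]) N)"
    unfolding mhs_snoc sum_distrib_left sum_distrib_right
    by (subst sum.swap) (simp only: mult_ac)
  finally show ?thesis .
qed

text \<open>The two sums in \<open>R_idx\<close> for an index \<open>u @ [- int p, b] @ v\<close>, evaluated by \<open>mhs\<close>.\<close>

definition right_terms :: "nat \<Rightarrow> index \<Rightarrow> int \<Rightarrow> index \<Rightarrow> nat \<Rightarrow> rat" where
  "right_terms p u b v N = 1 / of_nat (Suc p) * (\<Sum>i=0..p. of_nat (Suc p choose i)
     * bernoulli_minus i * mhs (u @ [b - int p - 1 + int i] @ v) N)"

definition left_terms :: "nat \<Rightarrow> index \<Rightarrow> index \<Rightarrow> nat \<Rightarrow> rat" where
  "left_terms p u v N = (if u = [] then 0 else 1 / of_nat (Suc p) * (\<Sum>i=0..p. of_nat (Suc p choose i)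
     * bernoulli_plus i * mhs (butlast u @ [last u - int p - 1 + int i] @ v) N))"

text \<open>The variable of the entry \<open>- int p\<close> lies between its left neighbour and
  \<open>n\<close>. The lower bound yields \<open>left_terms\<close>; the upper bound yields a
  polynomial in \<open>n\<close>, to be absorbed by the entry on the right.\<close>

lemma mhs_snoc_nonpos:
  assumes "n > 0"
  shows "mhs (u @ [- int p]) n
    = (faulhaber bernoulli_minus p n - (if p = 0 then 1 else 0)) * mhs u n - left_terms p u [] n"
proof (cases u rule: rev_cases)
  case Nil
  then show ?thesis
    using mhs_snoc_nonpos_Nil[OF assms] by (simp add: left_terms_def)
next
  case (snoc w a)
  then show ?thesis
    using mhs_snoc_nonpos_snoc[OF assms, of w a p] by (simp only: left_terms_def sum_faulhaber_mhs) simp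
qed

lemma left_terms_snoc:
  "left_terms p u (v @ [c]) N = (\<Sum>n=1..<N. of_nat n powi (- c) * left_terms p u v n)"
  using mhs_lincomb_snoc[where w = "\<lambda>i. butlast u @ [last u - int p - 1 + int i] @ v"]
  by (simp add: left_terms_def del: of_nat_Suc)

lemma right_terms_snoc:
  "right_terms p u b (v @ [c]) N = (\<Sum>n=1..<N. of_nat n powi (- c) * right_terms p u b v n)"
  using mhs_lincomb_snoc[where w = "\<lambda>i. u @ [b - int p - 1 + int i] @ v"]
  by (simp add: right_terms_def del: of_nat_Suc)

text \<open>With \<open>v\<close> empty, the variable of \<open>b\<close> is the upper bound of the
  inner sum, and its power absorbs the Faulhaber polynomial. Each entry of \<open>v\<close> then
  wraps all terms in one more sum.\<close>

lemma mhs_reduction: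
  "mhs (u @ [- int p, b] @ v) N
    = right_terms p u b v N - (if p = 0 then mhs (u @ [b] @ v) N else 0) - left_terms p u (b # v) N"
proof (induction v arbitrary: N rule: rev_induct)
  case Nil
  have "of_nat n powi (- b) * mhs (u @ [- int p]) n
      = faulhaber bernoulli_minus p n * (of_nat n powi (- b) * mhs u n)
        - (if p = 0 then of_nat n powi (- b) * mhs u n else 0)
        - of_nat n powi (- b) * left_terms p u [] n" if "n > 0" for n
    unfolding mhs_snoc_nonpos[OF that] by (simp only: algebra_simps split: if_split) simp
  then have "mhs ((u @ [- int p]) @ [b]) N
      = (\<Sum>n=1..<N. faulhaber bernoulli_minus p n * (of_nat n powi (- b) * mhs u n)
        - (if p = 0 then of_nat n powi (- b) * mhs u n else 0)
        - of_nat n powi (- b) * left_terms p u [] n)"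
    unfolding mhs_snoc[of _ b] by (intro sum.cong refl) simp
  also have "\<dots> = right_terms p u b [] N
      - (\<Sum>n=1..<N. if p = 0 then of_nat n powi (- b) * mhs u n else 0) - left_terms p u ([] @ [b]) N"
    unfolding left_terms_snoc sum_subtractf sum_faulhaber_mhs right_terms_def append_Nil2 ..
  also have "(\<Sum>n=1..<N. if p = 0 then of_nat n powi (- b) * mhs u n else 0)
      = (if p = 0 then mhs (u @ [b]) N else 0)"
    by (cases "p = 0") (simp_all only: mhs_snoc simp_thms if_True if_False sum.neutral_const)
  finally show ?case
    by simp
next
  case (snoc c v)
  have "mhs ((u @ [- int p, b] @ v) @ [c]) N
      = (\<Sum>n=1..<N. of_nat n powi (- c) * right_terms p u b v n
        - of_nat n powi (- c) * (if p = 0 then mhs (u @ [b] @ v) n else 0)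
        - of_nat n powi (- c) * left_terms p u (b # v) n)"
    unfolding mhs_snoc[of _ c] snoc.IH by (simp only: right_diff_distrib)
  also have "\<dots> = right_terms p u b (v @ [c]) N
      - (\<Sum>n=1..<N. of_nat n powi (- c) * (if p = 0 then mhs (u @ [b] @ v) n else 0))
      - left_terms p u ((b # v) @ [c]) N"
    unfolding right_terms_snoc left_terms_snoc sum_subtractf ..
  also have "(\<Sum>n=1..<N. of_nat n powi (- c) * (if p = 0 then mhs (u @ [b] @ v) n else 0))
      = (if p = 0 then mhs ((u @ [b] @ v) @ [c]) N else 0)"
    unfolding mhs_snoc[of _ c] by simp
  finally show ?case
    by simp
qed

text \<open>The last entry of a nonempty regularizable index is positive, so the first non-positive
  entry has a right neighbour \<open>b\<close>.\<close>

lemma split_at_first_nonpos: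
  assumes "regularizable k" "\<not> positive_index k"
  obtains u p b v where "k = u @ [- int p, b] @ v" "first_nonpos k = length u"
proof -
  define m where "m = first_nonpos k"
  have m: "m + 1 < length k" "k ! m \<le> 0"
    using first_nonpos[OF assms] by (simp_all add: m_def)
  have "drop m k = k ! m # k ! Suc m # drop (Suc (Suc m)) k"
    using m(1) by (metis Cons_nth_drop_Suc Suc_eq_plus1 Suc_lessD)
  then have "take m k @ [k ! m, k ! Suc m] @ drop (Suc (Suc m)) k = k"
    by (metis append_Cons append_Nil append_take_drop_id)
  moreover have "- int (nat (- (k ! m))) = k ! m"
    using m(2) by simp
  moreover have "length (take m k) = m"
    using m(1) by simp
  ultimately show ?thesis
    using that[of "take m k" "nat (- (k ! m))" "k ! Suc m" "drop (Suc (Suc m)) k"] m_def by metis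
qed

lemma R_idx_split:
  assumes "k = u @ [- int p, b] @ v" "first_nonpos k = length u"
  shows "R_idx k = qscale (1 / of_nat (Suc p)) (\<Sum>i=0..p.
        qscale (of_nat (Suc p choose i) * bernoulli_minus i)
          (basis (u @ [b - int p - 1 + int i] @ v)))
      - (if p = 0 then basis (u @ [b] @ v) else 0)
      - (if u = [] then 0 else qscale (1 / of_nat (Suc p)) (\<Sum>i=0..p.
          qscale (of_nat (Suc p choose i) * bernoulli_plus i)
            (basis (butlast u @ [last u - int p - 1 + int i] @ b # v))))"
proof -
  have "merge_right k (length u) i = u @ [b - int p - 1 + int i] @ v"
    "remove_entry k (length u) = u @ [b] @ v" for i
    by (simp_all add: assms(1) merge_right_def remove_entry_def nth_append)
  moreover have "merge_left k (length u) i = butlast u @ [last u - int p - 1 + int i] @ b # v"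
    if "u \<noteq> []" for i
    using that by (cases u rule: rev_cases)
      (simp_all add: assms(1) merge_left_def nth_append)
  moreover have "k ! length u = - int p"
    by (simp add: assms(1))
  moreover have "1 - (- int p) = int (Suc p)" "- int p = 0 \<longleftrightarrow> p = 0"
    "length u \<ge> 1 \<longleftrightarrow> u \<noteq> []"
    by (auto simp: Suc_le_eq)
  ultimately show ?thesis
    unfolding R_idx_def assms(2) Let_def
    by (cases "u = []")
      (simp_all only: minus_minus nat_int of_int_of_nat_eq simp_thms if_True if_False not_True_eq_False)
qed

lemma pairing_mhs_R_idx:
  assumes "regularizable k" "\<not> positive_index k"
  shows "pairing (\<lambda>j. mhs j N) (R_idx k) = mhs k N"
proof -
  obtain u p b v where k: "k = u @ [- int p, b] @ v" "first_nonpos k = length u"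
    using split_at_first_nonpos[OF assms] .
  show ?thesis
    unfolding R_idx_split[OF k] unfolding k(1) mhs_reduction
    by (simp add: pairing_diff pairing_qscale pairing_sum right_terms_def left_terms_def
        del: of_nat_Suc)
qed

section \<open>Admissibility and positivity\<close>

text \<open>The tail sums under the minimum in \<open>m_idx\<close> are the excesses of the nonempty
  suffixes; written on lists, they need no index arithmetic.\<close>

definition excess :: "index \<Rightarrow> int" where
  "excess k = (\<Sum>x\<leftarrow>k. x - 1)"

lemma excess_simps [simp]:
  "excess [] = 0" "excess (x # k) = x - 1 + excess k" "excess (k @ k') = excess k + excess k'"
  by (simp_all add: excess_def)

lemma m_idx_pos_iff:
  "m_idx k > 0 \<longleftrightarrow> (\<forall>t<length k. excess (drop t k) > 0)"
proof (cases "k = []")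
  case True
  then show ?thesis
    by (simp add: m_idx_def zero_extended_def)
next
  case False
  have "(\<Sum>i=t..<length k. k ! i - 1) = excess (drop t k)" for t
  proof -
    have "excess (drop t k) = (\<Sum>i<length k - t. k ! (t + i) - 1)"
      by (simp add: excess_def sum_list_sum_nth atLeast0LessThan)
    also have "\<dots> = (\<Sum>i=t..<length k. k ! i - 1)"
      by (rule sum.reindex_bij_witness[of _ "\<lambda>i. i - t" "\<lambda>i. t + i"]) auto
    finally show ?thesis ..
  qed
  then show ?thesis
    using False by (auto simp: m_idx_def zero_extended_def)
qed

lemma admissible_iff:
  "admissible k \<longleftrightarrow> (\<forall>u v. k = u @ v \<longrightarrow> v \<noteq> [] \<longrightarrow> excess v > 0)"
  unfolding admissible_def m_idx_pos_iff
proof safe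
  fix u v
  assume *: "\<forall>t<length (u @ v). excess (drop t (u @ v)) > 0" "v \<noteq> []"
  show "excess v > 0"
    using *(1)[rule_format, of "length u"] *(2) by simp
next
  fix t
  assume *: "\<forall>u v. k = u @ v \<longrightarrow> v \<noteq> [] \<longrightarrow> excess v > 0" "t < length k"
  show "excess (drop t k) > 0"
    using *(1)[rule_format, of "take t k" "drop t k"] *(2) by simp
qed

lemma admissible_Cons:
  "admissible (x # k) \<longleftrightarrow> excess (x # k) > 0 \<and> admissible k"
  unfolding admissible_iff by (fastforce simp: Cons_eq_append_conv)

text \<open>A nonempty suffix of \<open>u @ w\<close> either lies in \<open>w\<close> or contains
  it; in the second case it has at least the excess of the corresponding suffix of
  \<open>u @ v\<close>.\<close>

lemma admissible_append_mono:
  assumes "admissible (u @ v)" "admissible w" "excess v \<le> excess w"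
  shows "admissible (u @ w)"
  using assms by (induction u) (simp_all add: admissible_Cons)

lemma admissible_appendD: "admissible (u @ v) \<Longrightarrow> admissible v"
  by (induction u) (simp_all add: admissible_Cons)

lemma admissible_imp_regularizable: "admissible k \<Longrightarrow> regularizable k"
  by (simp add: admissible_def regularizable_def)

text \<open>Each term replaces a suffix of \<open>k\<close> by an admissible one of no smaller
  excess. The 1 subtracted in a merged entry balances the 1 no longer subtracted for the lost entry,
  and \<open>i\<close> is added on top; dropping \<open>- int p\<close> raises the excess by
  \<open>p + 1\<close>.\<close>

lemma admissible_keys_R_idx:
  assumes "admissible k" "\<not> positive_index k" "j \<in> Poly_Mapping.keys (R_idx k)"
  shows "admissible j"
proof -
  obtain u p b v where k: "k = u @ [- int p, b] @ v" "first_nonpos k = length u"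
    using split_at_first_nonpos[OF admissible_imp_regularizable[OF assms(1)] assms(2)] .
  have bv: "admissible (b # v)" and pbv: "admissible (- int p # b # v)"
    using assms(1) admissible_appendD[of u "- int p # b # v"]
    by (simp_all add: k(1) admissible_Cons)
  then have v: "admissible v"
    by (simp add: admissible_Cons)
  let ?right = "\<lambda>i. u @ [b - int p - 1 + int i] @ v"
  let ?left = "\<lambda>i. butlast u @ [last u - int p - 1 + int i] @ b # v"
  have right: "admissible (?right i)" for i
  proof (rule admissible_append_mono)
    show "admissible (u @ (- int p # b # v))"
      using assms(1) by (simp add: k(1))
  qed (use pbv v in \<open>simp_all add: admissible_Cons\<close>)
  have mid: "admissible (u @ [b] @ v)"
  proof (rule admissible_append_mono)
    show "admissible (u @ (- int p # b # v))"
      using assms(1) by (simp add: k(1))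
  qed (use bv in simp_all)
  have left: "admissible (?left i)" if "u \<noteq> []" for i
  proof (rule admissible_append_mono)
    show *: "admissible (butlast u @ (last u # - int p # b # v))"
      using assms(1) append_butlast_last_id[OF that]
      by (metis k(1) append.assoc append_Cons append_Nil)
    show "admissible ([last u - int p - 1 + int i] @ b # v)"
      using admissible_appendD[OF *] bv by (simp add: admissible_Cons)
  qed simp
  let ?P = "qscale (1 / of_nat (Suc p)) (\<Sum>i=0..p.
        qscale (of_nat (Suc p choose i) * bernoulli_minus i) (basis (?right i)))"
  let ?Q = "if p = 0 then basis (u @ [b] @ v) else 0"
  let ?S = "if u = [] then 0 else qscale (1 / of_nat (Suc p)) (\<Sum>i=0..p.
        qscale (of_nat (Suc p choose i) * bernoulli_plus i) (basis (?left i)))"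
  have "Poly_Mapping.keys ?P \<subseteq> ?right ` {0..p}"
    by (rule keys_qscale_sum_basis)
  moreover have "Poly_Mapping.keys ?Q \<subseteq> {u @ [b] @ v}"
    by (simp add: basis_def)
  moreover have "Poly_Mapping.keys ?S \<subseteq> (if u = [] then {} else ?left ` {0..p})"
    using keys_qscale_sum_basis[of _ "\<lambda>i. of_nat (Suc p choose i) * bernoulli_plus i" ?left "{0..p}"]
    by (cases "u = []") (simp_all only: if_True if_False keys_zero empty_subsetI simp_thms)
  moreover have "j \<in> Poly_Mapping.keys (?P - ?Q - ?S)"
    using assms(3) unfolding R_idx_split[OF k] .
  then have "j \<in> Poly_Mapping.keys ?P \<union> Poly_Mapping.keys ?Q \<union> Poly_Mapping.keys ?S"
    using keys_diff[of "?P - ?Q" ?S] keys_diff[of ?P ?Q] by blast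
  ultimately have "j \<in> ?right ` {0..p} \<union> {u @ [b] @ v} \<union> (if u = [] then {} else ?left ` {0..p})"
    by blast
  then show ?thesis
    using right mid left by (auto split: if_splits)
qed

section \<open>Supports of stuffle products\<close>

lemma keys_append_entry:
  "Poly_Mapping.keys (append_entry X a) \<subseteq> (\<lambda>k. k @ [a]) ` Poly_Mapping.keys X"
  unfolding append_entry_def using keys_lin_ext[of "\<lambda>k. basis (k @ [a])" X]
  by (auto simp: basis_def)

lemma keys_stuffle_index_snoc:
  assumes "j \<in> Poly_Mapping.keys (stuffle_index (x @ [a]) (x' @ [b]))"
  obtains i where "j = i @ [a]" "i \<in> Poly_Mapping.keys (stuffle_index x (x' @ [b]))"
    | i where "j = i @ [b]" "i \<in> Poly_Mapping.keys (stuffle_index (x @ [a]) x')"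
    | i where "j = i @ [a + b]" "i \<in> Poly_Mapping.keys (stuffle_index x x')"
proof -
  let ?A = "append_entry (stuffle_index x (x' @ [b])) a"
  let ?B = "append_entry (stuffle_index (x @ [a]) x') b"
  let ?C = "append_entry (stuffle_index x x') (a + b)"
  have "j \<in> Poly_Mapping.keys (?A + ?B + ?C)"
    using assms unfolding stuffle_index_snoc .
  then have "j \<in> Poly_Mapping.keys ?A \<or> j \<in> Poly_Mapping.keys ?B \<or> j \<in> Poly_Mapping.keys ?C"
    using subsetD[OF Poly_Mapping.keys_add[of "?A + ?B" ?C]]
      subsetD[OF Poly_Mapping.keys_add[of ?A ?B]] by (metis Un_iff)
  then show ?thesis
    using that by (auto dest!: subsetD[OF keys_append_entry])
qed

text \<open>Merging two entries \<open>a\<close> and \<open>b\<close> into \<open>a + b\<close> can only increase the excess.\<close>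

lemma stuffle_index_suffix:
  assumes "j \<in> Poly_Mapping.keys (stuffle_index k k')" "j = s @ t"
  shows "\<exists>u v u' v'. k = u @ v \<and> k' = u' @ v' \<and> (t \<noteq> [] \<longrightarrow> v \<noteq> [] \<or> v' \<noteq> [])
    \<and> excess v + excess v' \<le> excess t"
  using assms
proof (induction "length k + length k'" arbitrary: k k' j t rule: less_induct)
  case less
  show ?case
  proof (cases "k = [] \<or> k' = [] \<or> t = []")
    case True
    then consider "t = []" | "k = []" "j = k'" | "k' = []" "j = k"
      using less.prems(1)
      by (auto simp: stuffle_index_Nil_left stuffle_index_Nil_right basis_def split: if_splits)
    then show ?thesis
    proof cases
      case 1
      then show ?thesis
        by (intro exI[of _ k] exI[of _ "[]"] exI[of _ k'] exI[of _ "[]"]) simp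
    next
      case 2
      then show ?thesis
        using less.prems(2) by (intro exI[of _ "[]"] exI[of _ "[]"] exI[of _ s] exI[of _ t]) simp
    next
      case 3
      then show ?thesis
        using less.prems(2)
        by (intro exI[of _ s] exI[of _ t] exI[of _ "[]"] exI[of _ "[]"]) simp
    qed
  next
    case False
    obtain x a where k1: "k = x @ [a]"
      using False by (cases k rule: rev_cases) auto
    obtain x' b where k2: "k' = x' @ [b]"
      using False by (cases k' rule: rev_cases) auto
    obtain t0 c where k3: "t = t0 @ [c]"
      using False by (cases t rule: rev_cases) auto
    note k = k1 k2 k3
    from less.prems(1)[unfolded k] consider "c = a" "s @ t0 \<in> Poly_Mapping.keys (stuffle_index x k')"
      | "c = b" "s @ t0 \<in> Poly_Mapping.keys (stuffle_index k x')"
      | "c = a + b" "s @ t0 \<in> Poly_Mapping.keys (stuffle_index x x')"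
      by (rule keys_stuffle_index_snoc) (auto simp: less.prems(2) k)
    then show ?thesis
    proof cases
      case 1
      have "length x + length k' < length k + length k'"
        by (simp add: k(1))
      from less.hyps[OF this 1(2) refl] obtain u v u' v'
        where *: "x = u @ v" "k' = u' @ v'" "excess v + excess v' \<le> excess t0"
        by blast
      show ?thesis
        by (intro exI[of _ u] exI[of _ "v @ [a]"] exI[of _ u'] exI[of _ v'])
          (use * 1(1) k(1,3) in simp)
    next
      case 2
      have "length k + length x' < length k + length k'"
        by (simp add: k(2))
      from less.hyps[OF this 2(2) refl] obtain u v u' v'
        where *: "k = u @ v" "x' = u' @ v'" "excess v + excess v' \<le> excess t0"
        by blast
      show ?thesis
        by (intro exI[of _ u] exI[of _ v] exI[of _ u'] exI[of _ "v' @ [b]"])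
          (use * 2(1) k(2,3) in simp)
    next
      case 3
      have "length x + length x' < length k + length k'"
        by (simp add: k)
      from less.hyps[OF this 3(2) refl] obtain u v u' v'
        where *: "x = u @ v" "x' = u' @ v'" "excess v + excess v' \<le> excess t0"
        by blast
      show ?thesis
        by (intro exI[of _ u] exI[of _ "v @ [a]"] exI[of _ u'] exI[of _ "v' @ [b]"])
          (use * 3(1) k in simp)
    qed
  qed
qed

text \<open>The excess of a nonempty suffix is bounded below by the excesses of a suffix of
  \<open>k\<close> and one of \<open>k'\<close>. At least one of these is nonempty, and each
  nonempty one has positive excess.\<close>

lemma admissible_stuffle_index:
  assumes "admissible k" "admissible k'" "j \<in> Poly_Mapping.keys (stuffle_index k k')"
  shows "admissible j"
  unfolding admissible_iff
proof (intro allI impI)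
  fix s t :: index
  assume t: "j = s @ t" "t \<noteq> []"
  obtain u v u' v' where *: "k = u @ v" "k' = u' @ v'" "v \<noteq> [] \<or> v' \<noteq> []"
    "excess v + excess v' \<le> excess t"
    using stuffle_index_suffix[OF assms(3) t(1)] t(2) by blast
  have "v \<noteq> [] \<longrightarrow> excess v > 0" "v' \<noteq> [] \<longrightarrow> excess v' > 0"
    using assms(1,2) *(1,2) by (auto simp: admissible_iff)
  then show "excess t > 0"
    using *(3,4) by (cases "v = []"; cases "v' = []") simp_all
qed

lemma positive_index_snoc: "positive_index (k @ [a]) \<longleftrightarrow> positive_index k \<and> a > 0"
  by (auto simp: positive_index_def)

lemma positive_stuffle_index:
  assumes "positive_index k" "positive_index k'" "j \<in> Poly_Mapping.keys (stuffle_index k k')"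
  shows "positive_index j"
  using assms
proof (induction "length k + length k'" arbitrary: k k' j rule: less_induct)
  case less
  show ?case
  proof (cases "k = [] \<or> k' = []")
    case True
    then have "j = k \<or> j = k'"
      using less.prems(3)
      by (auto simp: stuffle_index_Nil_left stuffle_index_Nil_right basis_def split: if_splits)
    then show ?thesis
      using less.prems by blast
  next
    case False
    obtain x a where k1: "k = x @ [a]"
      using False by (cases k rule: rev_cases) auto
    obtain x' b where k2: "k' = x' @ [b]"
      using False by (cases k' rule: rev_cases) auto
    have pos: "positive_index x" "positive_index x'" "a > 0" "b > 0"
      using less.prems(1,2) by (simp_all add: k1 k2 positive_index_snoc)
    from less.prems(3)[unfolded k1 k2] show ?thesis
    proof (rule keys_stuffle_index_snoc)
      fix i
      assume "j = i @ [a]" "i \<in> Poly_Mapping.keys (stuffle_index x (x' @ [b]))"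
      then show ?thesis
        using less.hyps[of x k' i] less.prems(2) pos by (simp add: k1 k2 positive_index_snoc)
    next
      fix i
      assume "j = i @ [b]" "i \<in> Poly_Mapping.keys (stuffle_index (x @ [a]) x')"
      then show ?thesis
        using less.hyps[of k x' i] less.prems(1) pos by (simp add: k1 k2 positive_index_snoc)
    next
      fix i
      assume "j = i @ [a + b]" "i \<in> Poly_Mapping.keys (stuffle_index x x')"
      then show ?thesis
        using less.hyps[of x x' i] pos by (simp add: k1 k2 positive_index_snoc)
    qed
  qed
qed

lemma keys_stuffle_subset:
  assumes "X \<in> qspan S" "Y \<in> qspan S"
    "\<And>k k'. k \<in> S \<Longrightarrow> k' \<in> S \<Longrightarrow> Poly_Mapping.keys (stuffle_index k k') \<subseteq> T"
  shows "X \<star> Y \<in> qspan T"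
proof -
  let ?f = "\<lambda>k. lin_ext (\<lambda>k'. stuffle_index k k') Y"
  have "Poly_Mapping.keys (?f k) \<subseteq> T" if "k \<in> Poly_Mapping.keys X" for k
  proof (rule order_trans[OF keys_lin_ext UN_least])
    fix k'
    assume "k' \<in> Poly_Mapping.keys Y"
    then show "Poly_Mapping.keys (stuffle_index k k') \<subseteq> T"
      using assms(1,2) that by (intro assms(3)) (auto simp: qspan_def)
  qed
  then show ?thesis
    unfolding qspan_def stuffle_def mem_Collect_eq by (rule order_trans[OF keys_lin_ext UN_least])
qed

lemma stuffle_qspan_adm:
  assumes "X \<in> qspan I_adm" "Y \<in> qspan I_adm"
  shows "X \<star> Y \<in> qspan I_adm"
  using assms
proof (rule keys_stuffle_subset)
  show "Poly_Mapping.keys (stuffle_index k k') \<subseteq> I_adm" if "k \<in> I_adm" "k' \<in> I_adm" for k k'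
    using admissible_stuffle_index[of k k'] that by (auto simp: I_adm_def)
qed

lemma stuffle_qspan_adm_pos:
  assumes "X \<in> qspan I_adm_pos" "Y \<in> qspan I_adm_pos"
  shows "X \<star> Y \<in> qspan I_adm_pos"
  using assms
proof (rule keys_stuffle_subset)
  show "Poly_Mapping.keys (stuffle_index k k') \<subseteq> I_adm_pos"
    if "k \<in> I_adm_pos" "k' \<in> I_adm_pos" for k k'
    using admissible_stuffle_index[of k k'] positive_stuffle_index[of k k'] that
    by (auto simp: I_adm_pos_def)
qed

section \<open>Support and invariance of the positive-index map\<close>

lemma keys_pi_plus_index:
  assumes "admissible k"
  shows "Poly_Mapping.keys (pi_plus_index k) \<subseteq> I_adm_pos"
  using assms
proof (induction k rule: pi_plus_index.induct)
  case (1 k)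
  have reg: "regularizable k"
    using 1(2) by (rule admissible_imp_regularizable)
  show ?case
  proof (cases "positive_index k")
    case True
    then show ?thesis
      using reg 1(2) by (simp add: pi_plus_index.simps[of k] basis_def I_adm_pos_def)
  next
    case False
    have "Poly_Mapping.keys (pi_plus_index j) \<subseteq> I_adm_pos" if "j \<in> Poly_Mapping.keys (R_idx k)" for j
      using 1(1)[OF _ False that] reg admissible_keys_R_idx[OF 1(2) False that] by blast
    then show ?thesis
      using reg False keys_lin_ext[of pi_plus_index "R_idx k"]
      by (subst pi_plus_index.simps) (simp, blast)
  qed
qed

lemma pi_plus_qspan: "X \<in> qspan I_adm \<Longrightarrow> pi_plus X \<in> qspan I_adm_pos"
  using keys_lin_ext[of pi_plus_index X] keys_pi_plus_index
  by (fastforce simp: pi_plus_def qspan_def I_adm_def)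

text \<open>Every reduction step preserves the truncated sum and admissibility, and the recursion
  ends in positive indices, which are left as they are.\<close>

lemma pairing_mhs_pi_plus_index:
  assumes "admissible k"
  shows "pairing (\<lambda>j. mhs j N) (pi_plus_index k) = mhs k N"
  using assms
proof (induction k rule: pi_plus_index.induct)
  case (1 k)
  have reg: "regularizable k"
    using 1(2) by (rule admissible_imp_regularizable)
  show ?case
  proof (cases "positive_index k")
    case True
    then show ?thesis
      using reg by (simp add: pi_plus_index.simps[of k])
  next
    case False
    have "pairing (\<lambda>j. mhs j N) (pi_plus_index i) = mhs i N"
      if "i \<in> Poly_Mapping.keys (R_idx k)" for i
      using 1(1)[OF _ False that] reg admissible_keys_R_idx[OF 1(2) False that] by blast
    then have "pairing (\<lambda>j. mhs j N) (lin_ext pi_plus_index (R_idx k)) = mhs k N"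
      unfolding pairing_lin_ext pairing_mhs_R_idx[OF reg False, symmetric] by (rule pairing_cong)
    then show ?thesis
      using reg False by (subst pi_plus_index.simps) simp
  qed
qed

lemma pairing_mhs_pi_plus:
  assumes "X \<in> qspan I_adm"
  shows "pairing (\<lambda>k. mhs k N) (pi_plus X) = pairing (\<lambda>k. mhs k N) X"
  unfolding pi_plus_def pairing_lin_ext using assms
  by (intro pairing_cong pairing_mhs_pi_plus_index) (auto simp: qspan_def I_adm_def)

section \<open>Localization at a prime\<close>

text \<open>The localization of the integers at \<open>p\<close>. The divisibility condition also
  excludes \<open>b = 0\<close>, and fractions need not be reduced.\<close>

definition local_ring :: "nat \<Rightarrow> rat set" where
  "local_ring p = {of_int a / of_int b | a b. \<not> int p dvd b}"

text \<open>Only the difference has to be \<open>p\<close>-integral, not \<open>x\<close> and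
  \<open>y\<close>. Thus a scaled truncated sum can be compared first and recognized as
  \<open>p\<close>-integral afterwards.\<close>

definition local_cong :: "nat \<Rightarrow> rat \<Rightarrow> rat \<Rightarrow> bool" where
  "local_cong p x y \<longleftrightarrow> (\<exists>z\<in>local_ring p. x - y = of_nat p * z)"

lemma local_ringI: "\<not> int p dvd b \<Longrightarrow> of_int a / of_int b \<in> local_ring p"
  by (auto simp: local_ring_def)

lemma local_ring_of_int [simp]: "prime p \<Longrightarrow> of_int a \<in> local_ring p"
  using local_ringI[of p 1 a] by (cases "p = Suc 0") auto

lemma local_ring_0 [simp]: "prime p \<Longrightarrow> 0 \<in> local_ring p"
  and local_ring_1 [simp]: "prime p \<Longrightarrow> 1 \<in> local_ring p"
  using local_ring_of_int[of p 0] local_ring_of_int[of p 1] by simp_all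

lemma local_ring_of_nat [simp]: "prime p \<Longrightarrow> of_nat n \<in> local_ring p"
  using local_ring_of_int[of p "int n"] by simp

lemma local_ring_mult:
  assumes "prime p" "x \<in> local_ring p" "y \<in> local_ring p"
  shows "x * y \<in> local_ring p"
proof -
  obtain a b c d where *: "x = of_int a / of_int b" "\<not> int p dvd b"
    "y = of_int c / of_int d" "\<not> int p dvd d"
    using assms(2,3) unfolding local_ring_def by blast
  have "\<not> int p dvd b * d"
    using * assms(1) by (simp add: prime_dvd_mult_iff)
  moreover have "x * y = of_int (a * c) / of_int (b * d)"
    using * by simp
  ultimately show ?thesis
    using local_ringI by metis
qed

lemma local_ring_add:
  assumes "prime p" "x \<in> local_ring p" "y \<in> local_ring p"
  shows "x + y \<in> local_ring p"
proof -
  obtain a b c d where *: "x = of_int a / of_int b" "\<not> int p dvd b"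
    "y = of_int c / of_int d" "\<not> int p dvd d"
    using assms(2,3) unfolding local_ring_def by blast
  have "\<not> int p dvd b * d"
    using * assms(1) by (simp add: prime_dvd_mult_iff)
  moreover have "x + y = of_int (a * d + c * b) / of_int (b * d)"
    using * by (cases "b = 0 \<or> d = 0") (auto simp: add_frac_eq)
  ultimately show ?thesis
    using local_ringI by metis
qed

lemma local_ring_sum:
  "prime p \<Longrightarrow> (\<And>i. i \<in> I \<Longrightarrow> f i \<in> local_ring p) \<Longrightarrow> sum f I \<in> local_ring p"
  by (induction I rule: infinite_finite_induct) (simp_all add: local_ring_add)

lemma local_ring_power: "prime p \<Longrightarrow> x \<in> local_ring p \<Longrightarrow> x ^ n \<in> local_ring p"
  by (induction n) (simp_all add: local_ring_mult)

lemma local_ring_inverse_of_nat: "\<not> p dvd n \<Longrightarrow> inverse (of_nat n) \<in> local_ring p"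
  using local_ringI[of p "int n" 1] by (simp add: inverse_eq_divide)

lemma local_congI: "x - y = of_nat p * z \<Longrightarrow> z \<in> local_ring p \<Longrightarrow> local_cong p x y"
  by (auto simp: local_cong_def)

lemma local_cong_refl [simp]: "prime p \<Longrightarrow> local_cong p x x"
  by (rule local_congI[of _ _ _ 0]) simp_all

lemma local_cong_mult_left:
  assumes "prime p" "c \<in> local_ring p" "local_cong p x y"
  shows "local_cong p (c * x) (c * y)"
proof -
  obtain z where "z \<in> local_ring p" "x - y = of_nat p * z"
    using assms(3) by (auto simp: local_cong_def)
  then show ?thesis
    using assms(1,2)
    by (intro local_congI[of _ _ _ "c * z"]) (simp_all add: local_ring_mult flip: right_diff_distrib)
qed

lemma local_cong_add:
  assumes "prime p" "local_cong p x y" "local_cong p x' y'"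
  shows "local_cong p (x + x') (y + y')"
proof -
  obtain z z' where "z \<in> local_ring p" "x - y = of_nat p * z" "z' \<in> local_ring p" "x' - y' = of_nat p * z'"
    using assms(2,3) by (auto simp: local_cong_def)
  then show ?thesis
    using assms(1)
    by (intro local_congI[of _ _ _ "z + z'"]) (simp_all add: local_ring_add algebra_simps)
qed

lemma local_cong_trans:
  assumes "prime p" "local_cong p x y" "local_cong p y z"
  shows "local_cong p x z"
  using local_cong_add[OF assms] by (simp add: local_cong_def)

text \<open>The path is from \<open>x * x'\<close> over \<open>y * x'\<close> to
  \<open>y * y'\<close>; the two fixed factors \<open>x'\<close> and \<open>y\<close> must be
  \<open>p\<close>-integral, which congruence alone does not give.\<close>

lemma local_cong_mult:
  assumes "prime p" "local_cong p x y" "local_cong p x' y'" "x' \<in> local_ring p" "y \<in> local_ring p"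
  shows "local_cong p (x * x') (y * y')"
  using local_cong_trans[OF assms(1) local_cong_mult_left[OF assms(1,4,2)]
      local_cong_mult_left[OF assms(1,5,3), unfolded mult.commute[of y x']]]
  by (simp add: mult.commute)

lemma local_cong_sum:
  "prime p \<Longrightarrow> (\<And>i. i \<in> I \<Longrightarrow> local_cong p (f i) (g i)) \<Longrightarrow> local_cong p (sum f I) (sum g I)"
  by (induction I rule: infinite_finite_induct) (simp_all add: local_cong_add)

lemma local_cong_imp_local_ring:
  assumes "prime p" "local_cong p x y" "y \<in> local_ring p"
  shows "x \<in> local_ring p"
proof -
  obtain z where "z \<in> local_ring p" "x - y = of_nat p * z"
    using assms(2) by (auto simp: local_cong_def)
  then show ?thesis
    using local_ring_add[OF assms(1,3) local_ring_mult[OF assms(1) local_ring_of_nat[of p p], of z]] assms(1)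
    by (simp add: algebra_simps)
qed

lemma local_cong_power:
  assumes "prime p" "local_cong p x y" "y \<in> local_ring p"
  shows "local_cong p (x ^ n) (y ^ n)"
proof (induction n)
  case (Suc n)
  then show ?case
    using local_cong_mult[OF assms(1,2) Suc] local_cong_imp_local_ring[OF assms] assms
    by (simp add: local_ring_power)
qed (use assms in simp)

lemma local_cong_0_power_mult:
  assumes "prime p" "x \<in> local_ring p" "n > 0"
  shows "local_cong p (of_nat p ^ n * x) 0"
proof -
  have "of_nat p ^ n = of_nat p * (of_nat p ^ (n - 1) :: rat)"
    using assms(3) by (metis power_minus_mult mult.commute)
  then show ?thesis
    using assms(1,2) by (intro local_congI[of _ _ _ "of_nat p ^ (n - 1) * x"])
      (simp_all add: local_ring_mult local_ring_power)
qed

text \<open>A prime larger than the denominator of \<open>x\<close> cannot divide it.\<close>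

lemma local_ring_eventually:
  "\<exists>n. \<forall>p. prime p \<longrightarrow> p > n \<longrightarrow> x \<in> local_ring p"
proof -
  obtain a b where *: "quotient_of x = (a, b)"
    by fastforce
  have "x \<in> local_ring p" if "p > nat b" for p
  proof -
    have "b > 0"
      using quotient_of_denom_pos[OF *] .
    then have "\<not> int p dvd b"
      using that zdvd_imp_le[of "int p" b] by linarith
    then show ?thesis
      using quotient_of_div[OF *] local_ringI by metis
  qed
  then show ?thesis
    by blast
qed

text \<open>For nonzero \<open>x\<close>, some large prime \<open>p\<close> divides \<open>x\<close>
  in the local ring while \<open>inverse x\<close> is \<open>p\<close>-integral as well, so that
  \<open>p\<close> would be invertible there.\<close>

lemma eq_0_if_local_cong_0:
  assumes "\<And>p. prime p \<Longrightarrow> p > n \<Longrightarrow> local_cong p x 0"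
  shows "x = 0"
proof (rule ccontr)
  assume "x \<noteq> 0"
  obtain m where m: "\<And>p. prime p \<Longrightarrow> p > m \<Longrightarrow> inverse x \<in> local_ring p"
    using local_ring_eventually by blast
  obtain p where p: "prime p" "p > max n m"
    using bigger_prime by blast
  obtain z where z: "z \<in> local_ring p" "x = of_nat p * z"
    using assms[of p] p by (auto simp: local_cong_def)
  have "inverse x * z \<in> local_ring p"
    using p m z by (intro local_ring_mult) auto
  then obtain a b where *: "inverse x * z = of_int a / of_int b" "\<not> int p dvd b"
    by (auto simp: local_ring_def)
  have "b \<noteq> 0"
    using *(2) by auto
  have "1 = of_nat p * (of_int a / of_int b :: rat)"
    unfolding *(1)[symmetric] using \<open>x \<noteq> 0\<close> z(2) by (metis left_inverse mult.left_commute)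
  then have "(of_int b :: rat) = of_int (int p * a)"
    using \<open>b \<noteq> 0\<close> by (simp add: field_simps)
  then have "b = int p * a"
    by (simp only: of_int_eq_iff)
  then show False
    using *(2) by simp
qed

section \<open>Linear independence of truncated sums\<close>

lemma powi_uminus_pos:
  fixes x :: "'a :: division_ring"
  assumes "a > 0"
  shows "x powi (- a) = inverse x ^ nat a"
  using assms by (simp add: power_int_def)

text \<open>For positive indices, the exponent of \<open>p\<close> that clears all denominators when
  the summation variables stay below the square of \<open>p\<close>, since each is then divisible by
  \<open>p\<close> at most once.\<close>

definition weight :: "index \<Rightarrow> nat" where
  "weight k = nat (sum_list k)"

lemma weight_Nil [simp]: "weight [] = 0"
  by (simp add: weight_def)

lemma weight_snoc:
  assumes "positive_index (k @ [a])"
  shows "weight (k @ [a]) = weight k + nat a"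
proof -
  have "sum_list k \<ge> 0"
    using assms by (intro sum_list_nonneg) (force simp: positive_index_def)
  then show ?thesis
    using assms by (simp add: weight_def nat_add_distrib positive_index_snoc)
qed

text \<open>All summation variables are below \<open>p\<close>, hence invertible in the local
  ring.\<close>

lemma mhs_local_ring:
  assumes "prime p" "positive_index k" "n \<le> p"
  shows "mhs k n \<in> local_ring p"
  using assms(2,3)
proof (induction k arbitrary: n rule: rev_induct)
  case (snoc a k)
  have "of_nat m powi (- a) * mhs k m \<in> local_ring p" if "m \<in> {1..<n}" for m
  proof -
    have "\<not> p dvd m"
      using that snoc.prems(2) by (auto dest: dvd_imp_le)
    then show ?thesis
      using that snoc assms(1)
      by (auto simp: positive_index_snoc powi_uminus_pos
          intro!: local_ring_mult local_ring_power local_ring_inverse_of_nat)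
  qed
  then show ?case
    unfolding mhs_snoc by (intro local_ring_sum assms(1))
qed (use assms in simp)

text \<open>Scaled by its weight, a summand of \<open>mhs k\<close> survives modulo \<open>p\<close> only if all its summation
  variables are multiples of \<open>p\<close>.\<close>

lemma local_cong_mhs:
  assumes "prime p" "positive_index k" "N < p\<^sup>2"
  shows "local_cong p (of_nat p ^ weight k * mhs k (Suc N)) (mhs k (Suc (N div p)))"
  using assms(2,3)
proof (induction k arbitrary: N rule: rev_induct)
  case (snoc a k)
  have pos: "positive_index k" "a > 0"
    using snoc.prems(1) by (simp_all add: positive_index_snoc)
  have p0: "p > 0"
    using assms(1) by (simp add: prime_gt_0_nat)
  note w = weight_snoc[OF snoc.prems(1)]
  show ?case
    using snoc.prems(2)
  \<comment> \<open>The outer induction handles the inner sum \<open>mhs k\<close>; this one adds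
    the values of the last summation variable one at a time, \<open>T\<close> being the scaled new
    summand.\<close>
  proof (induction N)
    case 0
    then show ?case
      using assms(1) by simp
  next
    case (Suc N)
    have less: "N < p\<^sup>2" "Suc N < p\<^sup>2"
      using Suc.prems by simp_all
    note IH = Suc.IH[OF less(1)]
    have k: "local_cong p (of_nat p ^ weight k * mhs k (Suc N)) (mhs k (Suc (N div p)))"
      using snoc.IH[OF pos(1) less(1)] .
    have "N div p < p"
      using less(1) by (simp add: div_less_iff_less_mult p0 power2_eq_square)
    then have k_ring: "mhs k (Suc (N div p)) \<in> local_ring p"
      by (intro mhs_local_ring assms(1) pos(1)) simp
    define T where "T = of_nat p ^ weight (k @ [a]) * (of_nat (Suc N) powi (- a) * mhs k (Suc N))"
    have T: "T = (of_nat p * inverse (of_nat (Suc N))) ^ nat a * (of_nat p ^ weight k * mhs k (Suc N))"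
      unfolding T_def w powi_uminus_pos[OF pos(2)] by (simp add: power_add power_mult_distrib)
    have step: "of_nat p ^ weight (k @ [a]) * mhs (k @ [a]) (Suc (Suc N))
        = of_nat p ^ weight (k @ [a]) * mhs (k @ [a]) (Suc N) + T"
      unfolding T_def by (subst mhs_snoc_Suc) (simp_all add: distrib_left)
    show ?case
    proof (cases "p dvd Suc N")
      case True
      then obtain m where m: "Suc N = p * m"
        by blast
      have "m > 0"
        using m by (cases m) auto
      have "m < p"
        using less(2) m p0 by (simp add: power2_eq_square)
      \<comment> \<open>The inner sum runs up to \<open>N = p * m - 1\<close>, whose quotient by
        \<open>p\<close> is \<open>m - 1\<close>; so it reduces to \<open>mhs k m\<close>, as
        required for the summand \<open>m\<close> on the right-hand side.\<close>
      have div: "Suc N div p = m" "Suc (N div p) = m"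
        using m p0 True div_Suc[of N p] by (auto simp: mod_eq_0_iff_dvd)
      have "of_nat p * inverse (of_nat (Suc N)) = (inverse (of_nat m) :: rat)"
        unfolding m using p0 by simp
      moreover have "inverse (of_nat m) ^ nat a \<in> local_ring p"
        using \<open>m > 0\<close> \<open>m < p\<close> assms(1)
        by (intro local_ring_power local_ring_inverse_of_nat) (auto dest: dvd_imp_le)
      ultimately have "local_cong p T (of_nat m powi (- a) * mhs k m)"
        unfolding T powi_uminus_pos[OF pos(2)] using local_cong_mult_left[OF assms(1) _ k] div(2)
        by simp
      then show ?thesis
        unfolding step div(1) using local_cong_add[OF assms(1) IH] \<open>m > 0\<close>
        by (simp add: div(2) mhs_snoc_Suc)
    next
      case False
      \<comment> \<open>Here the last variable is a unit, so the factor
        \<open>of_nat p ^ nat a\<close> remains in full and makes the summand vanish modulo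
        \<open>p\<close>.\<close>
      have "T = of_nat p ^ nat a * (inverse (of_nat (Suc N)) ^ nat a * (of_nat p ^ weight k * mhs k (Suc N)))"
        unfolding T by (simp add: power_mult_distrib)
      then have "local_cong p T 0"
        using False pos(2) local_cong_imp_local_ring[OF assms(1) k k_ring] assms(1)
        by (auto intro!: local_cong_0_power_mult local_ring_mult local_ring_power local_ring_inverse_of_nat
            simp del: of_nat_Suc)
      moreover have "Suc N div p = N div p"
        using False by (simp add: div_Suc mod_eq_0_iff_dvd)
      ultimately show ?thesis
        unfolding step using local_cong_add[OF assms(1) IH, of T 0] by simp
    qed
  qed
qed (use assms in simp)

text \<open>Modulo \<open>p\<close> the number \<open>M * p + j\<close> is \<open>j\<close>, while
  the variables below it go up to \<open>M * p + j - 1\<close>, whose quotient by \<open>p\<close>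
  is \<open>M\<close>. So the last variable sees only \<open>j\<close> and the inner sum only
  \<open>M\<close>.\<close>

lemma local_cong_shift_mhs:
  assumes "prime p" "positive_index k" "M < p" "0 < j" "j < p"
  shows "local_cong p
      (inverse (of_nat (M * p + j)) ^ a * (of_nat p ^ weight k * mhs k (M * p + j)))
      (inverse (of_nat j) ^ a * mhs k (Suc M))" (is ?cong)
    and "inverse (of_nat j) ^ a * mhs k (Suc M) \<in> local_ring p" (is ?ring)
proof -
  let ?n = "M * p + j"
  have "\<not> p dvd j"
    using assms(4,5) by (auto dest: dvd_imp_le)
  then have nj: "inverse (of_nat ?n) \<in> local_ring p" "inverse (of_nat j) \<in> local_ring p"
    by (intro local_ring_inverse_of_nat; simp)+
  have ring: "mhs k (Suc M) \<in> local_ring p"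
    using assms by (intro mhs_local_ring) simp_all
  have "inverse (of_nat ?n) - inverse (of_nat j)
      = of_nat p * (of_int (- int M) * (inverse (of_nat ?n) * inverse (of_nat j)) :: rat)"
  proof -
    have "of_nat ?n \<noteq> (0 :: rat)" "of_nat j \<noteq> (0 :: rat)"
      using assms(4) by (simp_all only: of_nat_eq_0_iff)
    then have "inverse (of_nat ?n) - inverse (of_nat j)
        = - (inverse (of_nat ?n) * (of_nat ?n - of_nat j) * inverse (of_nat j) :: rat)"
      by (rule inverse_diff_inverse)
    then show ?thesis
      by (simp add: mult_ac)
  qed
  then have "local_cong p (inverse (of_nat ?n)) (inverse (of_nat j))"
    by (rule local_congI) (intro local_ring_mult local_ring_of_int assms(1) nj)
  then have pow: "local_cong p (inverse (of_nat ?n) ^ a) (inverse (of_nat j) ^ a)"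
    using nj by (intro local_cong_power assms(1))
  have "M * p + j \<le> M * p + p"
    using assms(5) by simp
  also have "\<dots> \<le> p * p"
    using assms(3) mult_le_mono1[of "Suc M" p p] by simp
  finally have "?n - 1 < p\<^sup>2"
    using assms(4) unfolding power2_eq_square by simp
  moreover have "(?n - 1) div p = M"
    using assms(4,5) by (intro div_nat_eqI) (simp_all add: algebra_simps)
  moreover have "Suc (?n - 1) = ?n"
    using assms(4) by simp
  ultimately have mhs: "local_cong p (of_nat p ^ weight k * mhs k ?n) (mhs k (Suc M))"
    using local_cong_mhs[OF assms(1,2), of "?n - 1"] by metis
  show ?cong
    using nj by (intro local_cong_mult[OF assms(1) pow mhs] local_ring_power assms(1)
        local_cong_imp_local_ring[OF assms(1) mhs ring])
  show ?ring
    using nj ring by (intro local_ring_mult local_ring_power assms(1))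
qed

text \<open>The sum is a polynomial with coefficients \<open>y a\<close>, evaluated at the
  infinitely many points \<open>inverse (of_nat j)\<close>.\<close>

lemma inverse_powers_independent:
  fixes y :: "nat \<Rightarrow> rat"
  assumes "finite A" "\<And>j. j > 0 \<Longrightarrow> (\<Sum>a\<in>A. y a * inverse (of_nat j) ^ a) = 0" "a \<in> A"
  shows "y a = 0"
proof -
  define P where "P = (\<Sum>a\<in>A. monom (y a) a)"
  have "range (\<lambda>j. inverse (of_nat (Suc j))) \<subseteq> {x. poly P x = 0}"
    using assms(2) by (auto simp: P_def poly_sum poly_monom simp del: of_nat_Suc)
  moreover have "infinite (range (\<lambda>j. inverse (of_nat (Suc j)) :: rat))"
    by (intro range_inj_infinite injI) (simp del: of_nat_Suc)
  ultimately have "P = 0"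
    using poly_roots_finite finite_subset by blast
  then have "coeff P a = 0"
    by simp
  then show ?thesis
    using assms(1,3) by (simp add: P_def coeff_sum)
qed

lemma mhs_Suc_diff:
  assumes "n > 0" "positive_index k" "k \<noteq> []"
  shows "mhs k (Suc n) - mhs k n = inverse (of_nat n) ^ nat (last k) * mhs (butlast k) n"
proof -
  obtain u a where k: "k = u @ [a]"
    using assms(3) by (cases k rule: rev_cases) auto
  then show ?thesis
    using assms(1,2) by (simp add: mhs_snoc_Suc positive_index_snoc powi_uminus_pos)
qed

text \<open>For the terms maximizing the weight of the index with its last entry removed, evaluating the
  difference of the relation at \<open>M * p + j\<close> for large primes \<open>p\<close> decouples the last summation
  variable, which becomes \<open>j\<close>, from the others, which become those of \<open>mhs\<close> at \<open>Suc M\<close>.\<close>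

lemma mhs_relation_top:
  fixes c :: "index \<Rightarrow> rat"
  assumes "finite K" "\<And>k. k \<in> K \<Longrightarrow> positive_index k \<and> k \<noteq> [] \<and> weight (butlast k) \<le> W"
    "\<And>n. n > 0 \<Longrightarrow> (\<Sum>k\<in>K. c k * (mhs k (Suc n) - mhs k n)) = 0" "j > 0"
  shows "(\<Sum>k | k \<in> K \<and> weight (butlast k) = W.
    c k * (inverse (of_nat j) ^ nat (last k) * mhs (butlast k) (Suc M))) = 0"
proof -
  have "\<forall>k. \<exists>n. \<forall>p. prime p \<longrightarrow> p > n \<longrightarrow> c k \<in> local_ring p"
    using local_ring_eventually by blast
  then obtain b where b: "\<And>k p. prime p \<Longrightarrow> p > b k \<Longrightarrow> c k \<in> local_ring p"
    by metis
  let ?t = "\<lambda>k. c k * (inverse (of_nat j) ^ nat (last k) * mhs (butlast k) (Suc M))"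
  \<comment> \<open>The sum of the nonnegative bounds \<open>b k\<close> dominates each of them, so
    all coefficients are \<open>p\<close>-integral; moreover \<open>M\<close> and \<open>j\<close>
    are below \<open>p\<close>.\<close>
  have "local_cong p (\<Sum>k | k \<in> K \<and> weight (butlast k) = W. ?t k) 0"
    if p: "prime p" "p > sum b K + M + j" for p
  proof -
    let ?n = "M * p + j"
    \<comment> \<open>The relation at \<open>?n\<close> is multiplied by
      \<open>of_nat p ^ W\<close>. Each term uses up the power of its own weight; a positive power
      is left over exactly for weights below \<open>W\<close>, and it kills those terms modulo
      \<open>p\<close>.\<close>
    let ?s = "\<lambda>k. of_nat p ^ (W - weight (butlast k)) * (c k *
      (inverse (of_nat ?n) ^ nat (last k) * (of_nat p ^ weight (butlast k) * mhs (butlast k) ?n)))"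
    have "local_cong p (?s k) (if weight (butlast k) = W then ?t k else 0)" if k: "k \<in> K" for k
    proof -
      have pos: "positive_index (butlast k)"
        using assms(2)[OF k] by (auto simp: positive_index_def dest: in_set_butlastD)
      have "b k \<le> sum b K"
        using k assms(1) by (intro member_le_sum) simp_all
      then have c: "c k \<in> local_ring p"
        using p by (intro b) simp_all
      note shift = local_cong_shift_mhs[OF p(1) pos, of M j "nat (last k)"]
      have cong: "local_cong p (c k * (inverse (of_nat ?n) ^ nat (last k)
          * (of_nat p ^ weight (butlast k) * mhs (butlast k) ?n))) (?t k)"
        using p assms(4) by (intro local_cong_mult_left shift c) simp_all
      have ring: "?t k \<in> local_ring p"
        using p assms(4) by (intro local_ring_mult[OF p(1) c] shift) simp_all
      show ?thesis
      proof (cases "weight (butlast k) = W")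
        case True
        then show ?thesis
          using cong by simp
      next
        case False
        then show ?thesis
          using assms(2)[OF k] local_cong_0_power_mult[OF p(1) local_cong_imp_local_ring[OF p(1) cong ring]]
          by simp
      qed
    qed
    then have "local_cong p (\<Sum>k\<in>K. ?s k) (\<Sum>k\<in>K. if weight (butlast k) = W then ?t k else 0)"
      by (intro local_cong_sum p(1))
    moreover have "(\<Sum>k\<in>K. ?s k) = of_nat p ^ W * (\<Sum>k\<in>K. c k * (mhs k (Suc ?n) - mhs k ?n))"
      unfolding sum_distrib_left
    proof (intro sum.cong refl)
      fix k
      assume k: "k \<in> K"
      have "of_nat p ^ W = of_nat p ^ (W - weight (butlast k)) * (of_nat p ^ weight (butlast k) :: rat)"
        using assms(2)[OF k] by (simp flip: power_add)
      moreover have "mhs k (Suc ?n) - mhs k ?n = inverse (of_nat ?n) ^ nat (last k) * mhs (butlast k) ?n"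
        using assms(2)[OF k] assms(4) by (intro mhs_Suc_diff) simp_all
      ultimately show "?s k = of_nat p ^ W * (c k * (mhs k (Suc ?n) - mhs k ?n))"
        by (simp only: mult_ac)
    qed
    moreover have "(\<Sum>k\<in>K. c k * (mhs k (Suc ?n) - mhs k ?n)) = 0"
      using assms(3,4) by simp
    moreover have "(\<Sum>k\<in>K. if weight (butlast k) = W then ?t k else 0)
        = (\<Sum>k | k \<in> K \<and> weight (butlast k) = W. ?t k)"
      using sum.inter_filter[OF assms(1), of ?t "\<lambda>k. weight (butlast k) = W"] by simp
    ultimately have "local_cong p 0 (\<Sum>k | k \<in> K \<and> weight (butlast k) = W. ?t k)"
      by (simp only: mult_zero_right)
    \<comment> \<open>The congruence is turned around by adding the negative of the sum and
      multiplying by -1.\<close>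
    then show ?thesis
      using local_cong_mult_left[OF p(1) local_ring_of_int[OF p(1), of "-1"]]
        local_cong_add[OF p(1) _ local_cong_refl[OF p(1)],
          of 0 _ "- (\<Sum>k | k \<in> K \<and> weight (butlast k) = W. ?t k)"]
      by fastforce
  qed
  then show ?thesis
    by (rule eq_0_if_local_cong_0)
qed

text \<open>Induction on a bound for the depth. Among the nonempty indices with nonzero coefficient,
  those whose weight without the last entry is maximal satisfy a polynomial relation in 1/j. Its
  coefficient at a fixed last entry is a relation among indices of smaller depth.\<close>

lemma mhs_independent:
  fixes c :: "index \<Rightarrow> rat"
  assumes "finite K" "\<And>k. k \<in> K \<Longrightarrow> positive_index k \<and> length k < d"
    "\<And>N. (\<Sum>k\<in>K. c k * mhs k (Suc N)) = 0" "k \<in> K"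
  shows "c k = 0"
  using assms
proof (induction d arbitrary: K c k)
  case (Suc d)
  \<comment> \<open>The empty index is left out because its truncated sum is constant and disappears
    from differences; zero coefficients are left out so that a single vanishing one gives a
    contradiction.\<close>
  define K' where "K' = {k \<in> K. k \<noteq> [] \<and> c k \<noteq> 0}"
  have fin: "finite K'"
    using Suc.prems(1) by (simp add: K'_def)
  have diff: "(\<Sum>k\<in>K'. c k * (mhs k (Suc n) - mhs k n)) = 0" if "n > 0" for n
  proof -
    have "(\<Sum>k\<in>K'. c k * (mhs k (Suc n) - mhs k n)) = (\<Sum>k\<in>K. c k * (mhs k (Suc n) - mhs k n))"
      using Suc.prems(1) by (intro sum.mono_neutral_left) (auto simp: K'_def)
    then show ?thesis
      using Suc.prems(3)[of n] Suc.prems(3)[of "n - 1"] that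
      by (simp add: right_diff_distrib sum_subtractf)
  qed
  have "K' = {}"
  proof (rule ccontr)
    assume "K' \<noteq> {}"
    define W where "W = Max ((\<lambda>k. weight (butlast k)) ` K')"
    define K0 where "K0 = {k \<in> K'. weight (butlast k) = W}"
    have "W \<in> (\<lambda>k. weight (butlast k)) ` K'"
      unfolding W_def using fin \<open>K' \<noteq> {}\<close> by (intro Max_in) simp_all
    then obtain k0 where k0: "k0 \<in> K0"
      by (auto simp: K0_def)
    define a where "a = nat (last k0)"
    define L where "L = {k \<in> K0. nat (last k) = a}"
    have finK0: "finite K0" and finL: "finite L"
      using fin by (simp_all add: K0_def L_def)
    have L: "k = butlast k @ [int a] \<and> positive_index (butlast k) \<and> length (butlast k) < d"
      if "k \<in> L" for k
    proof -
      have k: "k \<in> K" "k \<noteq> []" "nat (last k) = a"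
        using that by (auto simp: L_def K0_def K'_def)
      then obtain u x where u: "k = u @ [x]"
        by (cases k rule: rev_cases) auto
      then show ?thesis
        using k Suc.prems(2)[OF k(1)] by (auto simp: positive_index_snoc)
    qed
    \<comment> \<open>All indices in \<open>L\<close> end in the same entry, so removing it
      identifies no two of them and the shorter relation keeps each coefficient separate.\<close>
    then have inj: "inj_on butlast L"
      by (metis inj_onI)
    have "(\<Sum>u\<in>butlast ` L. c (u @ [int a]) * mhs u (Suc M)) = 0" for M
    proof -
      \<comment> \<open>The coefficient of the power \<open>x\<close> of 1/j in the relation for
        \<open>K0\<close>; at \<open>a\<close> it collects exactly \<open>L\<close>.\<close>
      let ?y = "\<lambda>x. \<Sum>k | k \<in> K0 \<and> nat (last k) = x. c k * mhs (butlast k) (Suc M)"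
      have "?y a = 0"
      proof (rule inverse_powers_independent[of "(\<lambda>k. nat (last k)) ` K0" ?y])
        fix j :: nat
        assume "j > 0"
        have "(\<Sum>k\<in>K0. c k * (inverse (of_nat j) ^ nat (last k) * mhs (butlast k) (Suc M))) = 0"
          unfolding K0_def using fin diff \<open>j > 0\<close> Suc.prems(2)
          by (intro mhs_relation_top) (auto simp: W_def K'_def)
        then show "(\<Sum>x\<in>(\<lambda>k. nat (last k)) ` K0. ?y x * inverse (of_nat j) ^ x) = 0"
          unfolding sum_distrib_right
          by (subst (asm) sum.image_gen[OF finK0, of _ "\<lambda>k. nat (last k)"]) (simp add: mult_ac)
      qed (use finK0 k0 in \<open>auto simp: a_def\<close>)
      moreover have "(\<Sum>u\<in>butlast ` L. c (u @ [int a]) * mhs u (Suc M))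
          = (\<Sum>k\<in>L. c k * mhs (butlast k) (Suc M))"
        unfolding sum.reindex[OF inj] o_def using L by (intro sum.cong refl) metis
      ultimately show ?thesis
        by (simp add: L_def)
    qed
    moreover have "k0 \<in> L"
      using k0 by (simp add: L_def a_def)
    ultimately have "c (butlast k0 @ [int a]) = 0"
      using finL L by (intro Suc.IH[of "butlast ` L" "\<lambda>u. c (u @ [int a])"]) auto
    then have "c k0 = 0"
      using L[OF \<open>k0 \<in> L\<close>] by simp
    then show False
      using k0 by (simp add: K0_def K'_def)
  qed
  then have nonempty: "c k = 0" if "k \<in> K" "k \<noteq> []" for k
    using that by (auto simp: K'_def)
  have "c [] = 0" if "[] \<in> K"
  proof -
    have "(\<Sum>k\<in>K. c k * mhs k (Suc 0)) = (\<Sum>k\<in>{[]}. c k * mhs k (Suc 0))"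
      using Suc.prems(1) that nonempty by (intro sum.mono_neutral_right) auto
    then show ?thesis
      using Suc.prems(3)[of 0] by simp
  qed
  then show ?case
    using nonempty Suc.prems(4) by blast
qed auto

lemma pairing_mhs_inject:
  assumes "\<And>k. k \<in> Poly_Mapping.keys X \<union> Poly_Mapping.keys Y \<Longrightarrow> positive_index k"
    "\<And>N. pairing (\<lambda>k. mhs k N) X = pairing (\<lambda>k. mhs k N) Y"
  shows "X = Y"
proof (rule ccontr)
  assume "X \<noteq> Y"
  then have "Poly_Mapping.keys (X - Y) \<noteq> {}"
    by simp
  then obtain k where k: "k \<in> Poly_Mapping.keys (X - Y)"
    by blast
  \<comment> \<open>The independence lemma needs some strict bound on the depths; the successor of
    the sum of all lengths is one.\<close>
  have "length j < Suc (\<Sum>j\<in>Poly_Mapping.keys (X - Y). length j)"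
    if "j \<in> Poly_Mapping.keys (X - Y)" for j
    using that member_le_sum[of j "Poly_Mapping.keys (X - Y)" length] by (simp add: less_Suc_eq_le)
  moreover have "positive_index j" if "j \<in> Poly_Mapping.keys (X - Y)" for j
    using subsetD[OF keys_diff that] assms(1) by simp
  moreover have "(\<Sum>j\<in>Poly_Mapping.keys (X - Y). Poly_Mapping.lookup (X - Y) j * mhs j (Suc N)) = 0"
    for N
    using assms(2) pairing_diff[of "\<lambda>k. mhs k (Suc N)" X Y] by (simp add: pairing_def)
  ultimately have "Poly_Mapping.lookup (X - Y) k = 0"
    using mhs_independent[of "Poly_Mapping.keys (X - Y)"
        "Suc (\<Sum>j\<in>Poly_Mapping.keys (X - Y). length j)" "Poly_Mapping.lookup (X - Y)" k] k
    by simp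
  then show False
    using k by (simp add: in_keys_iff)
qed

section \<open>The homomorphism property\<close>

theorem theorem5p6:
  shows "pi_plus \<in> qspan I_adm \<rightarrow> qspan I_adm_pos
    \<and> (\<forall>\<Sigma>\<in>qspan I_adm. \<forall>\<Sigma>'\<in>qspan I_adm. pi_plus (\<Sigma> + \<Sigma>') = pi_plus \<Sigma> + pi_plus \<Sigma>')
    \<and> (\<forall>c. \<forall>\<Sigma>\<in>qspan I_adm. pi_plus (qscale c \<Sigma>) = qscale c (pi_plus \<Sigma>))
    \<and> pi_plus (basis []) = basis []
    \<and> (\<forall>\<Sigma>\<in>qspan I_adm. \<forall>\<Sigma>'\<in>qspan I_adm. pi_plus (\<Sigma> \<star> \<Sigma>') = pi_plus \<Sigma> \<star> pi_plus \<Sigma>')"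
proof (intro conjI ballI allI)
  show "pi_plus \<in> qspan I_adm \<rightarrow> qspan I_adm_pos"
    using pi_plus_qspan by blast
  show "pi_plus (\<Sigma> + \<Sigma>') = pi_plus \<Sigma> + pi_plus \<Sigma>'" for \<Sigma> \<Sigma>'
    by (simp add: pi_plus_def lin_ext_add)
  show "pi_plus (qscale c \<Sigma>) = qscale c (pi_plus \<Sigma>)" for c \<Sigma>
    by (simp add: pi_plus_def lin_ext_qscale)
  have "regularizable []"
    by (simp add: regularizable_def m_idx_def)
  then show "pi_plus (basis []) = basis []"
    unfolding pi_plus_def lin_ext_basis
    by (subst pi_plus_index.simps) (simp add: positive_index_def)
  fix \<Sigma> \<Sigma>' :: index_comb
  assume adm: "\<Sigma> \<in> qspan I_adm" "\<Sigma>' \<in> qspan I_adm"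
  \<comment> \<open>Both sides are combinations of positive indices, which their truncated sums
    determine. By invariance and multiplicativity, either side evaluates to the product of the
    truncated sums of \<open>\<Sigma>\<close> and \<open>\<Sigma>'\<close>.\<close>
  show "pi_plus (\<Sigma> \<star> \<Sigma>') = pi_plus \<Sigma> \<star> pi_plus \<Sigma>'"
  proof (rule pairing_mhs_inject)
    have "pi_plus (\<Sigma> \<star> \<Sigma>') \<in> qspan I_adm_pos" "pi_plus \<Sigma> \<star> pi_plus \<Sigma>' \<in> qspan I_adm_pos"
      using adm by (simp_all add: stuffle_qspan_adm_pos stuffle_qspan_adm pi_plus_qspan)
    then show "positive_index k"
      if "k \<in> Poly_Mapping.keys (pi_plus (\<Sigma> \<star> \<Sigma>')) \<union> Poly_Mapping.keys (pi_plus \<Sigma> \<star> pi_plus \<Sigma>')" for k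
      using that by (auto simp: qspan_def I_adm_pos_def)
    show "pairing (\<lambda>k. mhs k N) (pi_plus (\<Sigma> \<star> \<Sigma>')) = pairing (\<lambda>k. mhs k N) (pi_plus \<Sigma> \<star> pi_plus \<Sigma>')"
      for N
      using adm by (simp add: pairing_mhs_stuffle pairing_mhs_pi_plus stuffle_qspan_adm)
  qed
qed

end
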